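(* A function $I(t,a,b,c,d,f)$, divisible by $abcdf$, satisfying the functional equation $$I(t,a,b,c,d,f)=I(t,\,t^{-1}ab\mathbb{L}^{-1},\,b,\,tcdf,\,df^2,\,f)+I(t,\,t^{-1}ab\mathbb{L}^{-1},\,a,\,tcdf,\,dc^2,\,c)+(\mathbb{L}-1)\cdot I(t,\,t^{-1}ab\mathbb{L}^{-1},\,1,\,tcdf,\,1,\,1)$$ and the symmetry condition $$I(t,a,b,c,d,f)=I(t,b,a,f,d,c)$$ is unique up to multiplication by a constant. That is, there is one such function $I_0$ such that every such function $I$ equals $\lambda I_0$ for some constant $\lambda$ (an element of the coefficient ring, i.e. not depending on $a,b,c,d,f$).
   Context: $K_0(Var_{\mathbb{C}})$ is the Grothendieck ring of quasiprojective complex algebraic varieties, generated by isomorphism classes $[X]$ with relations $[X]=[Y]+[X\setminus Y]$ for $Y\subset X$ Zariski closed and product $[X]\cdot[Y]=[X\times Y]$; $\mathbb{L}$ is the class of the complex line. $K_0(Var_{\mathbb{C}})[\mathbb{L}^{-1}]$ is filtered by the subgroups $F_k$ generated by the elements $[X]\cdot\mathbb{L}^{-n}$ with $n-\dim X\ge k$, and $\mathcal{M}$ is the completion with respect to this filtration. "Function" means a formal power series $$I(t,a,b,c,d,f)=\sum_{k_1,\dots,k_5\ge 0}g_{k_1,k_2,k_3,k_4,k_5}\,a^{k_1}b^{k_2}c^{k_3}d^{k_4}f^{k_5}$$ whose coefficients $g_{k_1,\dots,k_5}$ are formal Laurent series in $t$ over $\mathcal{M}$, i.e. elements of $\mathcal{M}((t))$.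 "Divisible by $abcdf$" means $g_{k_1,\dots,k_5}=0$ unless all $k_i\ge 1$. For the substitution $b=d=f=1$ in the last term of the equation to make sense, it is part of the hypothesis that for each fixed $k_1,k_3$ the sum $\sum_{k_2,k_4,k_5}g_{k_1,k_2,k_3,k_4,k_5}$ converges, coefficient by coefficient in $t$ with respect to the topology of $\mathcal{M}$, to an element of $\mathcal{M}((t))$. All substitutions are carried out termwise. *)

theory Defs
  imports
    "HOL-Analysis.Analysis"
    "HOL-Library.Multiset"
    "HOL-Library.Poly_Mapping"
    "HOL-Library.Product_Plus"
    "HOL-Library.FuncSet"
    "HOL-Computational_Algebra.Group_Closure"
    "HOL-Computational_Algebra.Formal_Laurent_Series"
begin

section \<open>Quasiprojective complex varieties\<close>

text \<open>
  Homogeneous polynomials of degree \<open>d\<close> are represented by the functions they induce on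
  coordinate vectors; as the field is infinite, nothing is lost.  The zero polynomial is a form
  of every degree.
\<close>

type_synonym cvec = "nat \<Rightarrow> complex"

inductive form :: "nat \<Rightarrow> (cvec \<Rightarrow> complex) \<Rightarrow> bool" where
  form_const: "form 0 (\<lambda>v. c)"
| form_coord: "form 1 (\<lambda>v. v i)"
| form_add: "form d f \<Longrightarrow> form d g \<Longrightarrow> form d (\<lambda>v. f v + g v)"
| form_mult: "form d f \<Longrightarrow> form e g \<Longrightarrow> form (d + e) (\<lambda>v. f v * g v)"

text \<open>
  A point of \<open>\<P>\<^sup>n\<close> is the set of all its homogeneous coordinate vectors \<open>(v\<^sub>0, \<dots>, v\<^sub>n)\<close>,
  extended by zeros.
\<close>

type_synonym ppoint = "cvec set"

definition hcoords :: "nat \<Rightarrow> cvec set" where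
  "hcoords n = {v. v \<noteq> (\<lambda>_. 0) \<and> (\<forall>i>n. v i = 0)}"

definition pclass :: "cvec \<Rightarrow> ppoint" where
  "pclass v = {\<lambda>i. c * v i |c. c \<noteq> 0}"

definition proj_space :: "nat \<Rightarrow> ppoint set" where
  "proj_space n = pclass ` hcoords n"

definition principal_open :: "nat \<Rightarrow> (cvec \<Rightarrow> complex) \<Rightarrow> ppoint set" where
  "principal_open n f = {p \<in> proj_space n. \<forall>v\<in>p. f v \<noteq> 0}"

definition zariski :: "nat \<Rightarrow> ppoint topology" where
  "zariski n = topology_generated_by {principal_open n f |f d. form d f}"

definition locally_closed :: "nat \<Rightarrow> ppoint set \<Rightarrow> bool" where
  "locally_closed n X \<longleftrightarrow>
     (\<exists>U C. openin (zariski n) U \<and> closedin (zariski n) C \<and> X = U \<inter> C)"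

text \<open>Varieties are reduced, but neither irreducible nor nonempty in general.\<close>

typedef qpvar = "{(n, X). locally_closed n X}"
  morphisms rep_qpvar abs_qpvar
  by (rule exI[of _ "(0, {})"]) (auto simp: locally_closed_def)

definition ambient :: "qpvar \<Rightarrow> nat" where
  "ambient X = fst (rep_qpvar X)"

definition points :: "qpvar \<Rightarrow> ppoint set" where
  "points X = snd (rep_qpvar X)"

definition var_topology :: "qpvar \<Rightarrow> ppoint topology" where
  "var_topology X = subtopology (zariski (ambient X)) (points X)"

text \<open>
  Regular maps are locally of the form \<open>[v] \<mapsto> [f\<^sub>0(v) : \<dots> : f\<^sub>m(v)]\<close> with forms of one common
  degree.  That the \<open>f\<^sub>i\<close> have no common zero on \<open>U \<inter> X\<close> is contained in the last line, since
  points consist of nonzero vectors.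
\<close>

definition regular_map :: "qpvar \<Rightarrow> qpvar \<Rightarrow> (ppoint \<Rightarrow> ppoint) \<Rightarrow> bool" where
  "regular_map X Y \<phi> \<longleftrightarrow> \<phi> \<in> points X \<rightarrow> points Y \<and>
     (\<forall>p\<in>points X. \<exists>U d f. openin (zariski (ambient X)) U \<and> p \<in> U \<and>
        (\<forall>i\<le>ambient Y. form d (f i)) \<and>
        (\<forall>q\<in>U \<inter> points X. \<forall>v\<in>q. (\<lambda>i. if i \<le> ambient Y then f i v else 0) \<in> \<phi> q))"

definition isomorphic :: "qpvar \<Rightarrow> qpvar \<Rightarrow> bool" where
  "isomorphic X Y \<longleftrightarrow> (\<exists>\<phi> \<psi>. regular_map X Y \<phi> \<and> regular_map Y X \<psi> \<and>
     (\<forall>p\<in>points X. \<psi> (\<phi> p) = p) \<and> (\<forall>q\<in>points Y. \<phi> (\<psi> q) = q))"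

definition irreducible_in :: "'a topology \<Rightarrow> 'a set \<Rightarrow> bool" where
  "irreducible_in T Z \<longleftrightarrow> Z \<noteq> {} \<and> Z \<subseteq> topspace T \<and>
     (\<forall>A B. closedin T A \<longrightarrow> closedin T B \<longrightarrow> Z \<subseteq> A \<union> B \<longrightarrow> Z \<subseteq> A \<or> Z \<subseteq> B)"

text \<open>
  The Krull dimension.  The empty variety gets dimension 0 instead of \<open>-\<infinity>\<close>; it is only used
  multiplied by the class of the empty variety, which is zero.
\<close>

definition var_dim :: "qpvar \<Rightarrow> nat" where
  "var_dim X = Sup {r. \<exists>Z. (\<forall>i\<le>r. closedin (var_topology X) (Z i) \<and> irreducible_in (var_topology X) (Z i))
                         \<and> (\<forall>i<r. Z i \<subset> Z (Suc i))}"


subsection \<open>Point, line and products\<close>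

lemma topspace_zariski [simp]: "topspace (zariski n) = proj_space n"
proof -
  have "principal_open n (\<lambda>v. 1) = proj_space n"
    by (auto simp: principal_open_def)
  then have "proj_space n \<in> {principal_open n f |f d. form d f}"
    using form_const[of 1] by blast
  then show ?thesis
    unfolding zariski_def topology_generated_by_topspace
    by (auto simp: principal_open_def)
qed

lemma openin_principal_open: "form d f \<Longrightarrow> openin (zariski n) (principal_open n f)"
  unfolding zariski_def by (rule topology_generated_by_Basis) blast

lemma locally_closed_proj_space: "locally_closed n (proj_space n)"
  unfolding locally_closed_def
  by (metis Int_absorb closedin_topspace openin_topspace topspace_zariski)

lemma locally_closed_principal_open: "form d f \<Longrightarrow> locally_closed n (principal_open n f)"
  unfolding locally_closed_def
  by (metis closedin_topspace inf.absorb1 openin_principal_open openin_subset)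

definition point_var :: qpvar where
  "point_var = abs_qpvar (0, proj_space 0)"

definition line_var :: qpvar where
  "line_var = abs_qpvar (1, principal_open 1 (\<lambda>v. v 0))"

lemma rep_point_var: "rep_qpvar point_var = (0, proj_space 0)"
  by (simp add: point_var_def abs_qpvar_inverse locally_closed_proj_space)

lemma rep_line_var: "rep_qpvar line_var = (1, principal_open 1 (\<lambda>v. v 0))"
  using locally_closed_principal_open[OF form_coord[of 0]]
  by (simp add: line_var_def abs_qpvar_inverse)

text \<open>
  The product is formed inside \<open>\<P>\<^sup>n \<times> \<P>\<^sup>m\<close>, which is regarded as a subset of
  \<open>\<P>\<^sup>N\<close>, \<open>N = (n+1)(m+1) - 1\<close>, by the Segre embedding.
\<close>

definition segre_vec :: "nat \<Rightarrow> nat \<Rightarrow> cvec \<Rightarrow> cvec \<Rightarrow> cvec" where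
  "segre_vec n m v w =
     (\<lambda>k. if k < Suc n * Suc m then v (k div Suc m) * w (k mod Suc m) else 0)"

definition segre_dim :: "nat \<Rightarrow> nat \<Rightarrow> nat" where
  "segre_dim n m = Suc n * Suc m - 1"

definition segre_product :: "nat \<Rightarrow> nat \<Rightarrow> ppoint set \<Rightarrow> ppoint set \<Rightarrow> ppoint set" where
  "segre_product n m X Y = {pclass (segre_vec n m v w) |p q v w. p \<in> X \<and> v \<in> p \<and> q \<in> Y \<and> w \<in> q}"

lemma pclass_self: "v \<in> pclass v"
  unfolding pclass_def by (rule CollectI, rule exI[of _ 1]) simp

lemma pclass_scale: "c \<noteq> 0 \<Longrightarrow> pclass (\<lambda>i. c * v i) = pclass v"
proof (intro equalityI subsetI)
  fix x assume c: "c \<noteq> 0" and "x \<in> pclass v"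
  then obtain e where e: "e \<noteq> 0" "x = (\<lambda>i. e * v i)" by (auto simp: pclass_def)
  have "e / c \<noteq> 0" "x = (\<lambda>i. (e / c) * (c * v i))" using c e by auto
  then show "x \<in> pclass (\<lambda>i. c * v i)" unfolding pclass_def by blast
next
  fix x assume c: "c \<noteq> 0" and "x \<in> pclass (\<lambda>i. c * v i)"
  then obtain e where e: "e \<noteq> 0" "x = (\<lambda>i. e * (c * v i))" by (auto simp: pclass_def)
  have "e * c \<noteq> 0" "x = (\<lambda>i. (e * c) * v i)" using c e by (auto simp: mult.assoc)
  then show "x \<in> pclass v" unfolding pclass_def by blast
qed

lemma pclass_eq: "v \<in> pclass w \<Longrightarrow> pclass v = pclass w"
proof -
  assume "v \<in> pclass w"
  then obtain c where c: "c \<noteq> 0" "v = (\<lambda>i. c * w i)" by (auto simp: pclass_def)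
  then show ?thesis using pclass_scale[OF c(1), of w] by simp
qed

lemma hcoords_scale: "v \<in> hcoords n \<Longrightarrow> c \<noteq> 0 \<Longrightarrow> (\<lambda>i. c * v i) \<in> hcoords n"
  by (auto simp: hcoords_def fun_eq_iff)

lemma mem_proj_space:
  assumes "p \<in> proj_space n" "v \<in> p"
  shows "v \<in> hcoords n" "p = pclass v"
proof -
  obtain w where w: "w \<in> hcoords n" "p = pclass w"
    using assms(1) by (auto simp: proj_space_def)
  then obtain c where "c \<noteq> 0" "v = (\<lambda>i. c * w i)"
    using assms(2) by (auto simp: pclass_def)
  then show "v \<in> hcoords n" using hcoords_scale w(1) by blast
  show "p = pclass v" using pclass_eq assms(2) w(2) by blast
qed

lemma form_homogeneous: "form d f \<Longrightarrow> f (\<lambda>i. c * v i) = c ^ d * f v"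
  by (induction rule: form.induct) (auto simp: algebra_simps power_add)

lemma mem_principal_open:
  assumes "form d f" "v \<in> hcoords n"
  shows "pclass v \<in> principal_open n f \<longleftrightarrow> f v \<noteq> 0"
  using assms pclass_self[of v]
  by (auto simp: principal_open_def proj_space_def pclass_def form_homogeneous[OF assms(1)])

lemma form_subst_coords:
  "form d f \<Longrightarrow> form d (\<lambda>v. f (\<lambda>i. if P i then v (\<sigma> i) else 0))"
proof (induction rule: form.induct)
  case (form_coord i)
  show ?case
  proof (cases "P i")
    case True
    then show ?thesis using form.form_coord[of "\<sigma> i"] by simp
  next
    case False
    have "form (0 + 1) (\<lambda>v. 0 * v 0)"
      by (intro form.form_mult form.form_const form.form_coord)
    then show ?thesis using False by simp
  qed
qed (auto intro: form.intros)

lemma segre_vec_nth: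
  assumes "i \<le> n" "j \<le> m"
  shows "segre_vec n m v w (i * Suc m + j) = v i * w j"
proof -
  have "i * Suc m + j < Suc i * Suc m" using assms by simp
  also have "\<dots> \<le> Suc n * Suc m" using assms by (intro mult_le_mono1) simp
  finally have "i * Suc m + j < Suc n * Suc m" .
  moreover have "(i * Suc m + j) div Suc m = i"
    using assms(2) div_mult_self3[of "Suc m" i j] by (simp del: mult_Suc_right)
  moreover have "(i * Suc m + j) mod Suc m = j"
    using assms(2) mod_mult_self3[of i "Suc m" j] by (simp del: mult_Suc_right)
  ultimately show ?thesis by (simp only: segre_vec_def if_True)
qed

lemma hcoords_nonzero: "v \<in> hcoords n \<Longrightarrow> \<exists>i\<le>n. v i \<noteq> 0"
  by (auto simp: hcoords_def fun_eq_iff) (meson not_le)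

lemma segre_vec_hcoords:
  assumes "v \<in> hcoords n" "w \<in> hcoords m"
  shows "segre_vec n m v w \<in> hcoords (segre_dim n m)"
proof -
  obtain i where i: "i \<le> n" "v i \<noteq> 0" using hcoords_nonzero[OF assms(1)] by blast
  obtain j where j: "j \<le> m" "w j \<noteq> 0" using hcoords_nonzero[OF assms(2)] by blast
  have "segre_vec n m v w (i * Suc m + j) \<noteq> 0"
    unfolding segre_vec_nth[OF i(1) j(1)] using i j by simp
  then have "segre_vec n m v w \<noteq> (\<lambda>_. 0)" by (auto simp only:)
  moreover have "segre_vec n m v w k = 0" if "k > segre_dim n m" for k
  proof -
    have "\<not> k < Suc n * Suc m" using that unfolding segre_dim_def by linarith
    then show ?thesis by (simp only: segre_vec_def if_False)
  qed
  ultimately show ?thesis by (simp add: hcoords_def)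
qed

lemma segre_left_open:
  assumes "openin (zariski n) U"
  shows "\<exists>W. openin (zariski (segre_dim n m)) W \<and>
    (\<forall>v\<in>hcoords n. \<forall>w\<in>hcoords m. pclass (segre_vec n m v w) \<in> W \<longleftrightarrow> pclass v \<in> U)"
proof -
  have "generate_topology_on {principal_open n f |f d. form d f} U"
    using assms by (simp add: zariski_def openin_topology_generated_by_iff)
  then show ?thesis
  proof (induction rule: generate_topology_on.induct)
    case Empty
    show ?case by (rule exI[of _ "{}"]) auto
  next
    case (Int a b)
    then obtain W W' where "openin (zariski (segre_dim n m)) W" "openin (zariski (segre_dim n m)) W'"
      "\<forall>v\<in>hcoords n. \<forall>w\<in>hcoords m. pclass (segre_vec n m v w) \<in> W \<longleftrightarrow> pclass v \<in> a"
      "\<forall>v\<in>hcoords n. \<forall>w\<in>hcoords m. pclass (segre_vec n m v w) \<in> W' \<longleftrightarrow> pclass v \<in> b"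
      by blast
    then show ?case by (intro exI[of _ "W \<inter> W'"]) auto
  next
    case (UN K)
    then obtain W where W: "\<And>k. k \<in> K \<Longrightarrow> openin (zariski (segre_dim n m)) (W k)"
      "\<And>k. k \<in> K \<Longrightarrow> \<forall>v\<in>hcoords n. \<forall>w\<in>hcoords m. pclass (segre_vec n m v w) \<in> W k \<longleftrightarrow> pclass v \<in> k"
      by metis
    then show ?case by (intro exI[of _ "\<Union>k\<in>K. W k"]) auto
  next
    case (Basis s)
    then obtain f d where f: "form d f" "s = principal_open n f" by blast
    define h where "h j = (\<lambda>z. f (\<lambda>i. if i \<le> n then z (i * Suc m + j) else 0))" for j
    have h: "form d (h j)" for j
      unfolding h_def by (rule form_subst_coords[OF f(1)])
    have eq: "h j (segre_vec n m v w) = w j ^ d * f v" if "v \<in> hcoords n" "j \<le> m" for v w j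
    proof -
      have "(\<lambda>i. if i \<le> n then segre_vec n m v w (i * Suc m + j) else 0) = (\<lambda>i. w j * v i)"
        using that by (auto simp: fun_eq_iff segre_vec_nth hcoords_def simp del: mult_Suc_right)
      then show ?thesis by (simp only: h_def form_homogeneous[OF f(1)])
    qed
    show ?case
    proof (intro exI[of _ "\<Union>j\<in>{..m}. principal_open (segre_dim n m) (h j)"] conjI ballI)
      show "openin (zariski (segre_dim n m)) (\<Union>j\<in>{..m}. principal_open (segre_dim n m) (h j))"
        by (intro openin_Union) (auto intro: openin_principal_open h)
      fix v w assume vw: "v \<in> hcoords n" "w \<in> hcoords m"
      obtain j where j: "j \<le> m" "w j \<noteq> 0" using vw(2) hcoords_nonzero by blast
      have "pclass (segre_vec n m v w) \<in> (\<Union>j\<in>{..m}. principal_open (segre_dim n m) (h j))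
        \<longleftrightarrow> (\<exists>j\<le>m. w j ^ d * f v \<noteq> 0)"
        using mem_principal_open[OF h segre_vec_hcoords[OF vw]] eq[OF vw(1)] by auto
      also have "\<dots> \<longleftrightarrow> f v \<noteq> 0" using j by auto
      also have "\<dots> \<longleftrightarrow> pclass v \<in> s"
        using mem_principal_open[OF f(1) vw(1)] f(2) by simp
      finally show "pclass (segre_vec n m v w) \<in> (\<Union>j\<in>{..m}. principal_open (segre_dim n m) (h j))
        \<longleftrightarrow> pclass v \<in> s" .
    qed
  qed
qed

lemma segre_right_open:
  assumes "openin (zariski m) U"
  shows "\<exists>W. openin (zariski (segre_dim n m)) W \<and>
    (\<forall>v\<in>hcoords n. \<forall>w\<in>hcoords m. pclass (segre_vec n m v w) \<in> W \<longleftrightarrow> pclass w \<in> U)"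
proof -
  have "generate_topology_on {principal_open m f |f d. form d f} U"
    using assms by (simp add: zariski_def openin_topology_generated_by_iff)
  then show ?thesis
  proof (induction rule: generate_topology_on.induct)
    case Empty
    show ?case by (rule exI[of _ "{}"]) auto
  next
    case (Int a b)
    then obtain W W' where "openin (zariski (segre_dim n m)) W" "openin (zariski (segre_dim n m)) W'"
      "\<forall>v\<in>hcoords n. \<forall>w\<in>hcoords m. pclass (segre_vec n m v w) \<in> W \<longleftrightarrow> pclass w \<in> a"
      "\<forall>v\<in>hcoords n. \<forall>w\<in>hcoords m. pclass (segre_vec n m v w) \<in> W' \<longleftrightarrow> pclass w \<in> b"
      by blast
    then show ?case by (intro exI[of _ "W \<inter> W'"]) auto
  next
    case (UN K)
    then obtain W where W: "\<And>k. k \<in> K \<Longrightarrow> openin (zariski (segre_dim n m)) (W k)"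
      "\<And>k. k \<in> K \<Longrightarrow> \<forall>v\<in>hcoords n. \<forall>w\<in>hcoords m. pclass (segre_vec n m v w) \<in> W k \<longleftrightarrow> pclass w \<in> k"
      by metis
    then show ?case by (intro exI[of _ "\<Union>k\<in>K. W k"]) auto
  next
    case (Basis s)
    then obtain f d where f: "form d f" "s = principal_open m f" by blast
    define h where "h i = (\<lambda>z. f (\<lambda>j. if j \<le> m then z (i * Suc m + j) else 0))" for i
    have h: "form d (h i)" for i
      unfolding h_def by (rule form_subst_coords[OF f(1)])
    have eq: "h i (segre_vec n m v w) = v i ^ d * f w" if "w \<in> hcoords m" "i \<le> n" for v w i
    proof -
      have "(\<lambda>j. if j \<le> m then segre_vec n m v w (i * Suc m + j) else 0) = (\<lambda>j. v i * w j)"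
        using that by (auto simp: fun_eq_iff segre_vec_nth hcoords_def simp del: mult_Suc_right)
      then show ?thesis by (simp only: h_def form_homogeneous[OF f(1)])
    qed
    show ?case
    proof (intro exI[of _ "\<Union>i\<in>{..n}. principal_open (segre_dim n m) (h i)"] conjI ballI)
      show "openin (zariski (segre_dim n m)) (\<Union>i\<in>{..n}. principal_open (segre_dim n m) (h i))"
        by (intro openin_Union) (auto intro: openin_principal_open h)
      fix v w assume vw: "v \<in> hcoords n" "w \<in> hcoords m"
      obtain i where i: "i \<le> n" "v i \<noteq> 0" using vw(1) hcoords_nonzero by blast
      have "pclass (segre_vec n m v w) \<in> (\<Union>i\<in>{..n}. principal_open (segre_dim n m) (h i))
        \<longleftrightarrow> (\<exists>i\<le>n. v i ^ d * f w \<noteq> 0)"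
        using mem_principal_open[OF h segre_vec_hcoords[OF vw]] eq[OF vw(2)] by auto
      also have "\<dots> \<longleftrightarrow> f w \<noteq> 0" using i by auto
      also have "\<dots> \<longleftrightarrow> pclass w \<in> s"
        using mem_principal_open[OF f(1) vw(2)] f(2) by simp
      finally show "pclass (segre_vec n m v w) \<in> (\<Union>i\<in>{..n}. principal_open (segre_dim n m) (h i))
        \<longleftrightarrow> pclass w \<in> s" .
    qed
  qed
qed

lemma mem_segre_product:
  assumes "X \<subseteq> proj_space n" "Y \<subseteq> proj_space m"
  shows "x \<in> segre_product n m X Y \<longleftrightarrow> (\<exists>v\<in>hcoords n. \<exists>w\<in>hcoords m.
     pclass v \<in> X \<and> pclass w \<in> Y \<and> x = pclass (segre_vec n m v w))"
proof
  assume "x \<in> segre_product n m X Y"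
  then obtain p q v w where "p \<in> X" "v \<in> p" "q \<in> Y" "w \<in> q" "x = pclass (segre_vec n m v w)"
    by (auto simp: segre_product_def)
  then show "\<exists>v\<in>hcoords n. \<exists>w\<in>hcoords m.
     pclass v \<in> X \<and> pclass w \<in> Y \<and> x = pclass (segre_vec n m v w)"
    using assms mem_proj_space by (metis subsetD)
next
  assume "\<exists>v\<in>hcoords n. \<exists>w\<in>hcoords m.
     pclass v \<in> X \<and> pclass w \<in> Y \<and> x = pclass (segre_vec n m v w)"
  then show "x \<in> segre_product n m X Y"
    using pclass_self unfolding segre_product_def by blast
qed

lemma segre_surface_closed:
  "closedin (zariski (segre_dim n m)) (segre_product n m (proj_space n) (proj_space m))"
proof -
  let ?N = "segre_dim n m"
  define \<mu> where "\<mu> = (\<lambda>(i, j, k, l). \<lambda>z::cvec.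
     z (i * Suc m + j) * z (k * Suc m + l) + (-1) * (z (i * Suc m + l) * z (k * Suc m + j)))"
  define I where "I = {(i, j, k, l). i \<le> n \<and> j \<le> m \<and> k \<le> n \<and> l \<le> m}"
  have \<mu>: "form 2 (\<mu> x)" for x
  proof -
    obtain i j k l where x: "x = (i, j, k, l)" by (metis prod_cases4)
    have "form (1 + 1) (\<lambda>z::cvec. z a * z b)" for a b
      by (intro form.form_mult form.form_coord)
    then have two: "form 2 (\<lambda>z::cvec. z a * z b)" for a b by (simp add: numeral_2_eq_2)
    have "form (0 + 2) (\<lambda>z::cvec. (-1) * (z a * z b))" for a b
      by (intro form.form_mult form.form_const two)
    then have "form 2 (\<lambda>z::cvec. (-1) * (z a * z b))" for a b by (simp only: add_0_left)
    then show ?thesis unfolding x \<mu>_def split by (intro form.form_add two)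
  qed
  have sub: "segre_product n m (proj_space n) (proj_space m) \<subseteq> proj_space ?N"
    using segre_vec_hcoords by (auto simp: mem_segre_product proj_space_def)
  have "proj_space ?N - segre_product n m (proj_space n) (proj_space m)
      = (\<Union>x\<in>I. principal_open ?N (\<mu> x))"
  proof (intro equalityI subsetI)
    fix p assume "p \<in> (\<Union>x\<in>I. principal_open ?N (\<mu> x))"
    then obtain x where x: "x \<in> I" "p \<in> principal_open ?N (\<mu> x)" by blast
    have "p \<notin> segre_product n m (proj_space n) (proj_space m)"
    proof
      assume "p \<in> segre_product n m (proj_space n) (proj_space m)"
      then obtain v w where vw: "v \<in> hcoords n" "w \<in> hcoords m" "p = pclass (segre_vec n m v w)"
        by (auto simp: mem_segre_product)
      have "\<mu> x (segre_vec n m v w) = 0"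
        using x(1) by (auto simp: I_def \<mu>_def segre_vec_nth simp del: mult_Suc_right)
      then show False
        using x(2) vw mem_principal_open[OF \<mu> segre_vec_hcoords] by blast
    qed
    then show "p \<in> proj_space ?N - segre_product n m (proj_space n) (proj_space m)"
      using x(2) by (auto simp: principal_open_def)
  next
    fix p assume p: "p \<in> proj_space ?N - segre_product n m (proj_space n) (proj_space m)"
    then obtain z where z: "z \<in> hcoords ?N" "p = pclass z" by (auto simp: proj_space_def)
    show "p \<in> (\<Union>x\<in>I. principal_open ?N (\<mu> x))"
    proof (rule ccontr)
      assume "p \<notin> (\<Union>x\<in>I. principal_open ?N (\<mu> x))"
      then have 0: "\<mu> x z = 0" if "x \<in> I" for x
        using that z mem_principal_open[OF \<mu> z(1)] by blast
      obtain c where c: "c \<le> ?N" "z c \<noteq> 0" using z(1) hcoords_nonzero by blast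
      define a where "a = c div Suc m"
      define b where "b = c mod Suc m"
      have cN: "c < Suc n * Suc m" using c(1) by (simp add: segre_dim_def)
      then have "a \<le> n" using less_mult_imp_div_less[of c "Suc n" "Suc m"] by (simp add: a_def)
      have "b \<le> m" using mod_less_divisor[of "Suc m" c] unfolding b_def by linarith
      have cab: "c = a * Suc m + b" unfolding a_def b_def by (simp only: div_mult_mod_eq)
      define v where "v = (\<lambda>i. if i \<le> n then z (i * Suc m + b) else 0)"
      define w where "w = (\<lambda>j. if j \<le> m then z (a * Suc m + j) / z c else 0)"
      have "v a \<noteq> 0" using c \<open>a \<le> n\<close> cab by (simp add: v_def)
      then have "v \<noteq> (\<lambda>_. 0)" by (auto simp only:)
      then have v: "v \<in> hcoords n" by (simp add: hcoords_def) (simp add: v_def)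
      have "w b \<noteq> 0" using c \<open>b \<le> m\<close> cab by (simp add: w_def)
      then have "w \<noteq> (\<lambda>_. 0)" by (auto simp only:)
      then have w: "w \<in> hcoords m" by (simp add: hcoords_def) (simp add: w_def)
      have "segre_vec n m v w = z"
      proof
        fix k
        show "segre_vec n m v w k = z k"
        proof (cases "k < Suc n * Suc m")
          case False
          then have "k > ?N" unfolding segre_dim_def by simp
          then have "z k = 0" using z(1) by (auto simp: hcoords_def)
          then show ?thesis using False by (simp only: segre_vec_def if_False)
        next
          case True
          define i where "i = k div Suc m"
          define j where "j = k mod Suc m"
          have "i \<le> n" using less_mult_imp_div_less[OF True] by (simp add: i_def)
          have "j \<le> m" using mod_less_divisor[of "Suc m" k] unfolding j_def by linarith
          have kij: "k = i * Suc m + j" unfolding i_def j_def by (simp only: div_mult_mod_eq)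
          have "(i, b, a, j) \<in> I"
            using \<open>i \<le> n\<close> \<open>j \<le> m\<close> \<open>a \<le> n\<close> \<open>b \<le> m\<close> by (simp add: I_def)
          from 0[OF this] have "z (i * Suc m + b) * z (a * Suc m + j) = z k * z c"
            unfolding \<mu>_def split kij[symmetric] cab[symmetric] by simp
          then have "v i * w j = z k"
            using \<open>i \<le> n\<close> \<open>j \<le> m\<close> c by (simp add: v_def w_def)
          then show ?thesis
            unfolding kij segre_vec_nth[OF \<open>i \<le> n\<close> \<open>j \<le> m\<close>] by simp
        qed
      qed
      then have "p \<in> segre_product n m (proj_space n) (proj_space m)"
        using v w z(2) by (subst mem_segre_product) (auto simp: proj_space_def)
      then show False using p by blast
    qed
  qed
  moreover have "openin (zariski ?N) (\<Union>x\<in>I. principal_open ?N (\<mu> x))"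
    by (intro openin_Union) (auto intro: openin_principal_open \<mu>)
  ultimately show ?thesis using sub by (simp add: closedin_def)
qed

lemma locally_closed_segre_product:
  assumes "locally_closed n X" "locally_closed m Y"
  shows "locally_closed (segre_dim n m) (segre_product n m X Y)"
proof -
  let ?T = "zariski (segre_dim n m)"
  let ?S = "segre_product n m (proj_space n) (proj_space m)"
  obtain U C where U: "openin (zariski n) U" and C: "closedin (zariski n) C" and X: "X = U \<inter> C"
    using assms(1) by (auto simp: locally_closed_def)
  obtain V D where V: "openin (zariski m) V" and D: "closedin (zariski m) D" and Y: "Y = V \<inter> D"
    using assms(2) by (auto simp: locally_closed_def)
  have sub: "X \<subseteq> proj_space n" "Y \<subseteq> proj_space m"
    using X Y openin_subset[OF U] openin_subset[OF V] by auto
  have co: "openin (zariski n) (proj_space n - C)" "openin (zariski m) (proj_space m - D)"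
    using C D by (auto simp: closedin_def)
  obtain A where A: "openin ?T A" "\<forall>v\<in>hcoords n. \<forall>w\<in>hcoords m.
      pclass (segre_vec n m v w) \<in> A \<longleftrightarrow> pclass v \<in> U"
    using segre_left_open[OF U, of m] by blast
  obtain A' where A': "openin ?T A'" "\<forall>v\<in>hcoords n. \<forall>w\<in>hcoords m.
      pclass (segre_vec n m v w) \<in> A' \<longleftrightarrow> pclass v \<in> proj_space n - C"
    using segre_left_open[OF co(1), of m] by blast
  obtain B where B: "openin ?T B" "\<forall>v\<in>hcoords n. \<forall>w\<in>hcoords m.
      pclass (segre_vec n m v w) \<in> B \<longleftrightarrow> pclass w \<in> V"
    using segre_right_open[OF V, of n] by blast
  obtain B' where B': "openin ?T B'" "\<forall>v\<in>hcoords n. \<forall>w\<in>hcoords m.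
      pclass (segre_vec n m v w) \<in> B' \<longleftrightarrow> pclass w \<in> proj_space m - D"
    using segre_right_open[OF co(2), of n] by blast
  have "segre_product n m X Y = (A \<inter> B) \<inter> (?S - (A' \<union> B'))"
  proof (intro equalityI subsetI)
    fix x assume "x \<in> segre_product n m X Y"
    then obtain v w where vw: "v \<in> hcoords n" "w \<in> hcoords m" "pclass v \<in> X" "pclass w \<in> Y"
        "x = pclass (segre_vec n m v w)"
      using mem_segre_product[OF sub] by blast
    then have "x \<in> ?S"
      using sub by (subst mem_segre_product) auto
    then show "x \<in> (A \<inter> B) \<inter> (?S - (A' \<union> B'))"
      using vw X Y A(2) B(2) A'(2) B'(2) by auto
  next
    fix x assume x: "x \<in> (A \<inter> B) \<inter> (?S - (A' \<union> B'))"
    then obtain v w where vw: "v \<in> hcoords n" "w \<in> hcoords m" "x = pclass (segre_vec n m v w)"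
      by (auto simp: mem_segre_product)
    then have "pclass v \<in> X" "pclass w \<in> Y"
      using x X Y A(2) B(2) A'(2) B'(2) by (auto simp: proj_space_def)
    then show "x \<in> segre_product n m X Y"
      using vw mem_segre_product[OF sub] by blast
  qed
  moreover have "closedin ?T (?S - (A' \<union> B'))"
    by (intro closedin_diff segre_surface_closed openin_Un A' B')
  ultimately show ?thesis
    unfolding locally_closed_def using A(1) B(1) openin_Int by blast
qed

definition var_times :: "qpvar \<Rightarrow> qpvar \<Rightarrow> qpvar" where
  "var_times X Y = abs_qpvar (segre_dim (ambient X) (ambient Y),
     segre_product (ambient X) (ambient Y) (points X) (points Y))"

lemma locally_closed_points: "locally_closed (ambient X) (points X)"
  using rep_qpvar[of X] by (auto simp: ambient_def points_def)

lemma rep_var_times: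
  "rep_qpvar (var_times X Y) = (segre_dim (ambient X) (ambient Y),
     segre_product (ambient X) (ambient Y) (points X) (points Y))"
  unfolding var_times_def
  by (simp add: abs_qpvar_inverse locally_closed_segre_product locally_closed_points)


section \<open>The Grothendieck ring\<close>

text \<open>
  The ring is given by generators and relations: the polynomial ring over the integers with one
  indeterminate per variety, modulo the ideal generated by the relations.

  The class \<open>comm_ring_1\<close> would include \<open>0 \<noteq> 1\<close>, i.e. the existence of a nontrivial
  motivic measure; the rings are therefore put into the sort
  \<open>{comm_ring, comm_monoid_mult}\<close> of commutative rings with unit.
\<close>

type_synonym var_poly = "qpvar multiset \<Rightarrow>\<^sub>0 int"

definition gen :: "qpvar \<Rightarrow> var_poly" where
  "gen X = Poly_Mapping.single {#X#} 1"

definition k0_relators :: "var_poly set" where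
  "k0_relators =
     {gen X - gen Y |X Y. isomorphic X Y} \<union>
     {gen X - (gen Y + gen Z) |X Y Z. ambient Y = ambient X \<and> ambient Z = ambient X \<and>
        closedin (var_topology X) (points Y) \<and> points Z = points X - points Y} \<union>
     {gen X * gen Y - gen (var_times X Y) |X Y. True} \<union>
     {gen point_var - 1}"

inductive_set ideal_closure :: "'a::comm_ring set \<Rightarrow> 'a set" for S where
  ideal_zero: "0 \<in> ideal_closure S"
| ideal_step: "x \<in> ideal_closure S \<Longrightarrow> s \<in> S \<Longrightarrow> x + r * s \<in> ideal_closure S"

lemma ideal_closure_add:
  "y \<in> ideal_closure S \<Longrightarrow> x \<in> ideal_closure S \<Longrightarrow> x + y \<in> ideal_closure S"
proof (induction rule: ideal_closure.induct)
  case (ideal_step y s r)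
  then show ?case
    using ideal_closure.ideal_step[of "x + y" S s r] by (simp add: add.assoc)
qed simp

lemma ideal_closure_mult: "x \<in> ideal_closure S \<Longrightarrow> a * x \<in> ideal_closure S"
proof (induction rule: ideal_closure.induct)
  case ideal_zero
  show ?case by (simp add: ideal_closure.ideal_zero)
next
  case (ideal_step x s r)
  then show ?case
    using ideal_closure.ideal_step[of "a * x" S s "a * r"] by (simp add: distrib_left mult.assoc)
qed

lemma ideal_closure_uminus: "x \<in> ideal_closure S \<Longrightarrow> - x \<in> ideal_closure S"
  for x :: "'a::comm_ring_1"
  using ideal_closure_mult[of x S "- 1"] by simp

definition k0_eq :: "var_poly \<Rightarrow> var_poly \<Rightarrow> bool" where
  "k0_eq p q \<longleftrightarrow> p - q \<in> ideal_closure k0_relators"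

lemma equivp_k0_eq: "equivp k0_eq"
proof (rule equivpI)
  show "reflp k0_eq" by (auto simp: reflp_def k0_eq_def ideal_zero)
  show "symp k0_eq"
  proof (rule sympI)
    fix p q assume "k0_eq p q"
    then show "k0_eq q p"
      using ideal_closure_uminus[of "p - q"] by (simp add: k0_eq_def)
  qed
  show "transp k0_eq"
  proof (rule transpI)
    fix p q r assume "k0_eq p q" "k0_eq q r"
    then show "k0_eq p r"
      using ideal_closure_add[of "q - r" _ "p - q"] by (simp add: k0_eq_def)
  qed
qed

quotient_type k0 = var_poly / k0_eq
  by (rule equivp_k0_eq)

instantiation k0 :: "{comm_ring, comm_monoid_mult}"
begin

lift_definition zero_k0 :: k0 is 0 .

lift_definition one_k0 :: k0 is 1 .

lift_definition plus_k0 :: "k0 \<Rightarrow> k0 \<Rightarrow> k0" is "(+)"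
  unfolding k0_eq_def using ideal_closure_add by (metis add_diff_add)

lift_definition uminus_k0 :: "k0 \<Rightarrow> k0" is uminus
  unfolding k0_eq_def using ideal_closure_uminus by (metis minus_diff_eq minus_diff_minus)

lift_definition minus_k0 :: "k0 \<Rightarrow> k0 \<Rightarrow> k0" is "(-)"
proof -
  fix a b c d :: var_poly assume "k0_eq a b" "k0_eq c d"
  then have "(a - b) + - (c - d) \<in> ideal_closure k0_relators"
    unfolding k0_eq_def by (intro ideal_closure_add ideal_closure_uminus)
  then show "k0_eq (a - c) (b - d)" by (simp add: k0_eq_def algebra_simps)
qed

lift_definition times_k0 :: "k0 \<Rightarrow> k0 \<Rightarrow> k0" is "(*)"
proof -
  fix a b c d :: var_poly assume "k0_eq a b" "k0_eq c d"
  then have "c * (a - b) + b * (c - d) \<in> ideal_closure k0_relators"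
    unfolding k0_eq_def by (intro ideal_closure_add ideal_closure_mult)
  then show "k0_eq (a * c) (b * d)" by (simp add: k0_eq_def algebra_simps)
qed

instance
proof
  have refl: "k0_eq p q" if "p = q" for p q
    using that by (simp add: k0_eq_def ideal_zero)
  fix a b c :: k0
  show "a + b + c = a + (b + c)" by transfer (rule refl, simp add: algebra_simps)
  show "a + b = b + a" by transfer (rule refl, simp add: algebra_simps)
  show "0 + a = a" by transfer (rule refl, simp)
  show "- a + a = 0" by transfer (rule refl, simp)
  show "a - b = a + - b" by transfer (rule refl, simp)
  show "a * b * c = a * (b * c)" by transfer (rule refl, simp add: algebra_simps)
  show "a * b = b * a" by transfer (rule refl, simp add: algebra_simps)
  show "(a + b) * c = a * c + b * c" by transfer (rule refl, simp add: algebra_simps)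
  show "1 * a = a" by transfer (rule refl, simp)
qed

end

lift_definition k0_class :: "qpvar \<Rightarrow> k0" is gen .

definition k0_L :: k0 where
  "k0_L = k0_class line_var"


subsection \<open>Inverting the class of the line\<close>

text \<open>A pair \<open>(x, n)\<close> stands for the fraction \<open>x / \<bbbL>\<^sup>n\<close>.\<close>

definition frac_eq :: "k0 \<times> nat \<Rightarrow> k0 \<times> nat \<Rightarrow> bool" where
  "frac_eq = (\<lambda>(x, m) (y, n). \<exists>k. k0_L ^ k * (k0_L ^ n * x) = k0_L ^ k * (k0_L ^ m * y))"

lemma equivp_frac_eq: "equivp frac_eq"
proof (rule equivpI)
  show "reflp frac_eq" by (auto simp: reflp_def frac_eq_def)
  show "symp frac_eq" unfolding symp_def frac_eq_def by (clarsimp, metis)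
  show "transp frac_eq"
  proof (rule transpI)
    fix a b c assume ab: "frac_eq a b" and bc: "frac_eq b c"
    obtain x m y n z p where a: "a = (x, m)" "b = (y, n)" "c = (z, p)"
      by (metis surj_pair)
    obtain k j where k: "k0_L ^ k * (k0_L ^ n * x) = k0_L ^ k * (k0_L ^ m * y)"
      and j: "k0_L ^ j * (k0_L ^ p * y) = k0_L ^ j * (k0_L ^ n * z)"
      using ab bc a by (auto simp: frac_eq_def)
    have "k0_L ^ (k + j + n) * (k0_L ^ p * x) = k0_L ^ j * k0_L ^ p * (k0_L ^ k * (k0_L ^ n * x))"
      by (simp add: power_add ac_simps)
    also have "\<dots> = k0_L ^ k * k0_L ^ m * (k0_L ^ j * (k0_L ^ p * y))"
      unfolding k by (simp add: ac_simps)
    also have "\<dots> = k0_L ^ (k + j + n) * (k0_L ^ m * z)"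
      unfolding j by (simp add: power_add ac_simps)
    finally show "frac_eq a c" using a by (auto simp: frac_eq_def)
  qed
qed

quotient_type k0_loc = "k0 \<times> nat" / frac_eq
  by (rule equivp_frac_eq)

instantiation k0_loc :: "{comm_ring, comm_monoid_mult}"
begin

lift_definition zero_k0_loc :: k0_loc is "(0, 0)" .

lift_definition one_k0_loc :: k0_loc is "(1, 0)" .

lift_definition plus_k0_loc :: "k0_loc \<Rightarrow> k0_loc \<Rightarrow> k0_loc"
  is "\<lambda>(x, m) (y, n). (k0_L ^ n * x + k0_L ^ m * y, m + n)"
proof (clarsimp simp: frac_eq_def)
  fix x m x' m' y n y' n' k j
  assume k: "k0_L ^ k * (k0_L ^ m' * x) = k0_L ^ k * (k0_L ^ m * x')"
    and j: "k0_L ^ j * (k0_L ^ n' * y) = k0_L ^ j * (k0_L ^ n * y')"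
  have "k0_L ^ (k + j) * (k0_L ^ (m' + n') * (k0_L ^ n * x + k0_L ^ m * y))
      = k0_L ^ j * k0_L ^ n' * k0_L ^ n * (k0_L ^ k * (k0_L ^ m' * x))
      + k0_L ^ k * k0_L ^ m' * k0_L ^ m * (k0_L ^ j * (k0_L ^ n' * y))"
    by (simp add: power_add distrib_left ac_simps)
  also have "\<dots> = k0_L ^ (k + j) * (k0_L ^ (m + n) * (k0_L ^ n' * x' + k0_L ^ m' * y'))"
    unfolding k j by (simp add: power_add distrib_left ac_simps)
  finally show "\<exists>k. k0_L ^ k * (k0_L ^ (m' + n') * (k0_L ^ n * x + k0_L ^ m * y))
      = k0_L ^ k * (k0_L ^ (m + n) * (k0_L ^ n' * x' + k0_L ^ m' * y'))" ..
qed

lift_definition uminus_k0_loc :: "k0_loc \<Rightarrow> k0_loc" is "\<lambda>(x, m). (- x, m)"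
  by (auto simp: frac_eq_def)

definition minus_k0_loc :: "k0_loc \<Rightarrow> k0_loc \<Rightarrow> k0_loc" where
  "minus_k0_loc a b = a + - b"

lift_definition times_k0_loc :: "k0_loc \<Rightarrow> k0_loc \<Rightarrow> k0_loc"
  is "\<lambda>(x, m) (y, n). (x * y, m + n)"
proof (clarsimp simp: frac_eq_def)
  fix x m x' m' y n y' n' k j
  assume k: "k0_L ^ k * (k0_L ^ m' * x) = k0_L ^ k * (k0_L ^ m * x')"
    and j: "k0_L ^ j * (k0_L ^ n' * y) = k0_L ^ j * (k0_L ^ n * y')"
  have "k0_L ^ (k + j) * (k0_L ^ (m' + n') * (x * y))
      = (k0_L ^ k * (k0_L ^ m' * x)) * (k0_L ^ j * (k0_L ^ n' * y))"
    by (simp add: power_add ac_simps)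
  also have "\<dots> = k0_L ^ (k + j) * (k0_L ^ (m + n) * (x' * y'))"
    unfolding k j by (simp add: power_add ac_simps)
  finally show "\<exists>k. k0_L ^ k * (k0_L ^ (m' + n') * (x * y))
      = k0_L ^ k * (k0_L ^ (m + n) * (x' * y'))" ..
qed

instance
proof
  have refl: "frac_eq p q" if "p = q" for p q
    using that equivp_reflp[OF equivp_frac_eq] by simp
  fix a b c :: k0_loc
  show "a + b + c = a + (b + c)"
    by transfer (rule refl, clarsimp simp: power_add distrib_left ac_simps)
  show "a + b = b + a" by transfer (rule refl, clarsimp simp: ac_simps)
  show "0 + a = a" by transfer (rule refl, clarsimp)
  show "- a + a = 0" by transfer (clarsimp simp: frac_eq_def)
  show "a - b = a + - b" by (simp add: minus_k0_loc_def)
  show "a * b * c = a * (b * c)" by transfer (rule refl, clarsimp simp: ac_simps)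
  show "a * b = b * a" by transfer (rule refl, clarsimp simp: ac_simps)
  show "(a + b) * c = a * c + b * c"
    by transfer (clarsimp simp: frac_eq_def power_add distrib_left distrib_right ac_simps)
  show "1 * a = a" by transfer (rule refl, clarsimp)
qed

end

definition loc_of :: "k0 \<Rightarrow> k0_loc" where
  "loc_of x = abs_k0_loc (x, 0)"

definition LL :: k0_loc where
  "LL = loc_of k0_L"

definition LL_inv :: k0_loc where
  "LL_inv = abs_k0_loc (1, 1)"

lemma LL_inverse: "LL * LL_inv = 1"
  by (simp add: LL_def LL_inv_def loc_of_def times_k0_loc.abs_eq one_k0_loc.abs_eq
      k0_loc.abs_eq_iff frac_eq_def)

definition LL_powi :: "int \<Rightarrow> k0_loc" where
  "LL_powi n = (if n \<ge> 0 then LL ^ nat n else LL_inv ^ nat (- n))"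

definition motivic_filtration :: "int \<Rightarrow> k0_loc set" where
  "motivic_filtration k =
     group_closure {loc_of (k0_class X) * LL_powi (- n) |X n. n - int (var_dim X) \<ge> k}"


section \<open>Completion with respect to a filtration\<close>

text \<open>
  A Hausdorff topological ring together with a map \<open>\<iota>\<close> is the completion of a ring with respect
  to a decreasing filtration \<open>F\<close> by subgroups if \<open>\<iota>\<close> is a ring homomorphism with dense image,
  the closures of the images of the \<open>F k\<close> form a basis of neighbourhoods of zero, they induce
  the filtration \<open>F\<close>, and all Cauchy sequences converge.  These conditions determine the
  topological ring up to a unique isomorphism compatible with \<open>\<iota>\<close>.  The map \<open>\<iota>\<close> need not be injective:
  its kernel is the intersection of all \<open>F k\<close>.
\<close>

locale filtration_completion =
  fixes F :: "int \<Rightarrow> 'k::{comm_ring, comm_monoid_mult} set"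
    and \<iota> :: "'k \<Rightarrow> 'm::{comm_ring_1, topological_ab_group_add, topological_semigroup_mult, t2_space}"
  assumes hom_add: "\<iota> (x + y) = \<iota> x + \<iota> y"
    and hom_mult: "\<iota> (x * y) = \<iota> x * \<iota> y"
    and hom_one: "\<iota> 1 = 1"
    and dense: "closure (range \<iota>) = UNIV"
    and open_iff: "open U \<longleftrightarrow> (\<forall>x\<in>U. \<exists>k. \<forall>y. y - x \<in> closure (\<iota> ` F k) \<longrightarrow> y \<in> U)"
    and induced_filtration: "\<iota> x \<in> closure (\<iota> ` F k) \<longleftrightarrow> x \<in> F k"
    and complete: "(\<forall>k. \<exists>N. \<forall>i\<ge>N. \<forall>j\<ge>N. s i - s j \<in> closure (\<iota> ` F k)) \<Longrightarrow> convergent (s :: nat \<Rightarrow> 'm)"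


section \<open>Series in five variables over a ring of Laurent series\<close>

text \<open>Sums in \<open>\<M>((t))\<close>, taken coefficient by coefficient in \<open>t\<close>.\<close>

definition fls_has_sum ::
  "('i \<Rightarrow> 'm::{comm_monoid_add, topological_space} fls) \<Rightarrow> 'i set \<Rightarrow> 'm fls \<Rightarrow> bool" where
  "fls_has_sum f A s \<longleftrightarrow> (\<forall>n. ((\<lambda>i. fls_nth (f i) n) has_sum (fls_nth s n)) A)"

definition fls_infsum :: "('i \<Rightarrow> 'm::{comm_monoid_add, t2_space} fls) \<Rightarrow> 'i set \<Rightarrow> 'm fls" where
  "fls_infsum f A = (THE s. fls_has_sum f A s)"

text \<open>
  A series is given by its coefficients.  What is substituted for its variables are terms
  \<open>r a\<^bsup>e\<^sub>1\<^esup> b\<^bsup>e\<^sub>2\<^esup> c\<^bsup>e\<^sub>3\<^esup> d\<^bsup>e\<^sub>4\<^esup> f\<^bsup>e\<^sub>5\<^esup>\<close>.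
\<close>

type_synonym expo = "nat \<times> nat \<times> nat \<times> nat \<times> nat"

type_synonym 'r series = "expo \<Rightarrow> 'r"

datatype 'r mono = Mono (mcoeff: 'r) (mexpo: expo)

instantiation mono :: (comm_monoid_mult) comm_monoid_mult
begin

definition one_mono :: "'a mono" where
  "one_mono = Mono 1 0"

definition times_mono :: "'a mono \<Rightarrow> 'a mono \<Rightarrow> 'a mono" where
  "times_mono x y = Mono (mcoeff x * mcoeff y) (mexpo x + mexpo y)"

instance
proof
  fix x y z :: "'a mono"
  show "x * y * z = x * (y * z)"
    by (simp add: times_mono_def mult.assoc add.assoc)
  show "x * y = y * x"
    by (simp only: times_mono_def mult.commute[of "mcoeff x"] add.commute[of "mexpo x"])
  show "1 * x = x"
    by (simp only: times_mono_def one_mono_def mono.sel mult_1_left add_0_left mono.collapse)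
qed

end

definition Const :: "'r \<Rightarrow> 'r mono" where
  "Const r = Mono r 0"

definition Va :: "'r::one mono" where "Va = Mono 1 (1, 0, 0, 0, 0)"
definition Vb :: "'r::one mono" where "Vb = Mono 1 (0, 1, 0, 0, 0)"
definition Vc :: "'r::one mono" where "Vc = Mono 1 (0, 0, 1, 0, 0)"
definition Vd :: "'r::one mono" where "Vd = Mono 1 (0, 0, 0, 1, 0)"
definition Vf :: "'r::one mono" where "Vf = Mono 1 (0, 0, 0, 0, 1)"

fun subst_mono :: "'r::comm_monoid_mult mono \<Rightarrow> 'r mono \<Rightarrow> 'r mono \<Rightarrow> 'r mono \<Rightarrow> 'r mono \<Rightarrow> expo \<Rightarrow> 'r mono" where
  "subst_mono A B C D E (k1, k2, k3, k4, k5) = A ^ k1 * B ^ k2 * C ^ k3 * D ^ k4 * E ^ k5"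

text \<open>The coefficients of \<open>I(t, A, B, C, D, E)\<close>.\<close>

definition substitute ::
  "'m::{comm_ring_1, t2_space} fls series \<Rightarrow> 'm fls mono \<Rightarrow> 'm fls mono \<Rightarrow> 'm fls mono \<Rightarrow> 'm fls mono \<Rightarrow> 'm fls mono
     \<Rightarrow> 'm fls series" where
  "substitute I A B C D E = (\<lambda>e.
     fls_infsum (\<lambda>k. I k * mcoeff (subst_mono A B C D E k))
       {k. mexpo (subst_mono A B C D E k) = e})"

definition divisible_by_abcdf :: "'r::zero series \<Rightarrow> bool" where
  "divisible_by_abcdf I \<longleftrightarrow> (\<forall>k1 k2 k3 k4 k5.
     I (k1, k2, k3, k4, k5) \<noteq> 0 \<longrightarrow> k1 \<ge> 1 \<and> k2 \<ge> 1 \<and> k3 \<ge> 1 \<and> k4 \<ge> 1 \<and> k5 \<ge> 1)"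

definition summable_bdf :: "'m::{comm_monoid_add, topological_space} fls series \<Rightarrow> bool" where
  "summable_bdf I \<longleftrightarrow>
     (\<forall>k1 k3. \<exists>s. fls_has_sum (\<lambda>(k2, k4, k5). I (k1, k2, k3, k4, k5)) UNIV s)"

text \<open>The functional equation, for given elements \<open>L\<close> and \<open>L' = L\<^sup>-\<^sup>1\<close> of the coefficient ring.\<close>

definition functional_equation :: "'m::{comm_ring_1, t2_space} \<Rightarrow> 'm \<Rightarrow> 'm fls series \<Rightarrow> bool" where
  "functional_equation L L' I \<longleftrightarrow>
     (let A = Const (fls_X_inv * fls_const L') * Va * Vb;
          C = Const fls_X * Vc * Vd * Vf
      in \<forall>e. I e = substitute I A Vb C (Vd * Vf ^ 2) Vf e
                 + substitute I A Va C (Vd * Vc ^ 2) Vc e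
                 + (fls_const L - 1) * substitute I A 1 C 1 1 e)"

definition symmetric :: "'m::{comm_ring_1, t2_space} fls series \<Rightarrow> bool" where
  "symmetric I \<longleftrightarrow> I = substitute I Vb Va Vf Vd Vc"

definition solution :: "'m::{comm_ring_1, t2_space} \<Rightarrow> 'm \<Rightarrow> 'm fls series \<Rightarrow> bool" where
  "solution L L' I \<longleftrightarrow> divisible_by_abcdf I \<and> summable_bdf I \<and> functional_equation L L' I \<and> symmetric I"

end

theory Submission
  imports Defs
begin

text \<open>
  By divisibility, the coefficient of the functional equation at \<open>(k\<^sub>1, \<dots>, k\<^sub>5)\<close> involves only the
  first term if \<open>k\<^sub>1 < k\<^sub>2\<close>, only the second if \<open>k\<^sub>1 > k\<^sub>2\<close> and only the third if \<open>k\<^sub>1 = k\<^sub>2\<close>.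
  The first two perform the steps of the subtractive Euclidean algorithm on \<open>(k\<^sub>1, k\<^sub>2)\<close> and reduce
  every coefficient to the diagonal ones \<open>h\<^sub>P\<^sub>,\<^sub>q\<close> at \<open>(P, P, q, q, q)\<close>.

  Uniqueness: if the diagonal coefficients vanish below \<open>P\<close>, the sum \<open>S\<close> in the third term at
  \<open>(P, P, q, q, q)\<close> is \<open>h\<^sub>P\<^sub>,\<^sub>q + u S\<close> with \<open>u = t^(q-P) \<bbbL>^(-P)\<close>, while
  \<open>h\<^sub>P\<^sub>,\<^sub>q = (\<bbbL> - 1) u S\<close>, so \<open>S = \<bbbL> u S\<close>.  This forces \<open>S = 0\<close> unless \<open>P = q = 1\<close>.
  Hence a solution is determined by its coefficient at \<open>abcdf\<close>.

  Existence: the coefficient of \<open>I\<^sub>0\<close> at \<open>(m, n, m\<^sup>2, m n, n\<^sup>2)\<close> is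
  \<open>H (gcd m n) t^(mn-m-n) \<bbbL>^(-m-n)\<close>, and the equation becomes
  \<open>H p = (\<bbbL> - 1) \<Sum>\<^sub>n H (gcd p n) t^((p-1)n) \<bbbL>^(-n)\<close>, summed over \<open>n \<ge> 1\<close>.  For \<open>p = 1\<close> this is the
  geometric series, and for \<open>p \<ge> 2\<close> it is a recursion for the coefficients in \<open>t\<close>.
\<close>

section \<open>Sums of Laurent series\<close>

lemma fls_has_sum_unique:
  fixes f :: "'i \<Rightarrow> 'm::{topological_comm_monoid_add, t2_space} fls"
  assumes "fls_has_sum f A s" "fls_has_sum f A s'"
  shows "s = s'"
  using assms unfolding fls_has_sum_def by (metis fls_eqI has_sum_unique)

lemma fls_infsumI:
  fixes f :: "'i \<Rightarrow> 'm::{topological_comm_monoid_add, t2_space} fls"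
  assumes "fls_has_sum f A s"
  shows "fls_infsum f A = s"
  unfolding fls_infsum_def using assms fls_has_sum_unique by blast

lemma fls_has_sum_cong_neutral:
  assumes "\<And>x. x \<in> T - S \<Longrightarrow> g x = 0" "\<And>x. x \<in> S - T \<Longrightarrow> f x = 0"
    and "\<And>x. x \<in> S \<inter> T \<Longrightarrow> f x = g x"
  shows "fls_has_sum f S s \<longleftrightarrow> fls_has_sum g T s"
  unfolding fls_has_sum_def
  by (intro all_cong1 has_sum_cong_neutral) (auto simp: assms)

lemma fls_has_sum_reindex:
  "inj_on h A \<Longrightarrow> fls_has_sum g (h ` A) s \<longleftrightarrow> fls_has_sum (\<lambda>x. g (h x)) A s"
  unfolding fls_has_sum_def by (simp add: has_sum_reindex o_def)

lemma fls_has_sum_singleton: "fls_has_sum f {x} (f x)"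
  unfolding fls_has_sum_def by (simp add: has_sum_finiteI)

lemma fls_has_sum_empty: "fls_has_sum f {} 0"
  unfolding fls_has_sum_def by simp

lemma fls_has_sum_add:
  fixes f g :: "'i \<Rightarrow> 'm::topological_comm_monoid_add fls"
  assumes "fls_has_sum f A s" "fls_has_sum g A s'"
  shows "fls_has_sum (\<lambda>i. f i + g i) A (s + s')"
  using assms unfolding fls_has_sum_def by (auto intro: has_sum_add)

lemma fls_has_sum_diff:
  fixes f g :: "'i \<Rightarrow> 'm::topological_ab_group_add fls"
  assumes "fls_has_sum f A s" "fls_has_sum g A s'"
  shows "fls_has_sum (\<lambda>i. f i - g i) A (s - s')"
proof -
  have "((\<lambda>i. fls_nth (f i) n + - fls_nth (g i) n) has_sum (fls_nth s n + - fls_nth s' n)) A" for n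
    using assms unfolding fls_has_sum_def by (intro has_sum_add) (auto simp: has_sum_uminus)
  then show ?thesis by (simp add: fls_has_sum_def)
qed

section \<open>Sums multiplied by monomials and by Laurent series\<close>

text \<open>\<open>weight \<bbbL>\<^sup>-\<^sup>1 p q = t^(q-p) \<bbbL>^(-p)\<close>\<close>

definition weight :: "'m::comm_ring_1 \<Rightarrow> nat \<Rightarrow> nat \<Rightarrow> 'm fls" where
  "weight c p q = (fls_X_inv * fls_const c) ^ p * fls_X ^ q"

lemma weight_times_nth: "fls_nth (weight c p q * f) n = c ^ p * fls_nth f (n + int p - int q)"
proof -
  have "weight c p q * f = fls_X_inv ^ p * (fls_X ^ q * (fls_const (c ^ p) * f))"
    by (simp add: weight_def power_mult_distrib fls_const_power ac_simps)
  then show ?thesis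
    by (simp add: fls_X_power_times_conv_shift fls_X_inv_power_times_conv_shift add_diff_eq)
qed

lemma weight_mult: "weight c p q * weight c p' q' = weight c (p + p') (q + q')"
  by (simp add: weight_def power_add ac_simps)

text \<open>A monomial factor only shifts coefficients and scales them by a constant, so it passes
  through a sum without any bound on pole orders.\<close>

lemma fls_has_sum_weight:
  fixes f :: "'i \<Rightarrow> 'm::{comm_ring_1, topological_semigroup_mult} fls"
  assumes "fls_has_sum f A s"
  shows "fls_has_sum (\<lambda>i. weight c p q * f i) A (weight c p q * s)"
  using assms unfolding fls_has_sum_def weight_times_nth by (auto intro: has_sum_cmult_right)

lemma has_sum_sum_finite:
  fixes f :: "'j \<Rightarrow> 'i \<Rightarrow> 'm::topological_comm_monoid_add"
  assumes "finite J" "\<And>j. j \<in> J \<Longrightarrow> (f j has_sum s j) A"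
  shows "((\<lambda>i. \<Sum>j\<in>J. f j i) has_sum (\<Sum>j\<in>J. s j)) A"
  using assms by (induction J rule: finite_induct) (auto intro: has_sum_add)

text \<open>
  Multiplication by a Laurent series mixes infinitely many coefficients, so it commutes with
  infinite sums only under a common bound for the pole orders.
\<close>

lemma fls_has_sum_cmult:
  fixes f :: "'i \<Rightarrow> 'm::{comm_ring_1, topological_ab_group_add, topological_semigroup_mult, t2_space} fls"
  assumes sum: "fls_has_sum f A s" and bound: "\<And>i n. i \<in> A \<Longrightarrow> n < b \<Longrightarrow> fls_nth (f i) n = 0"
  shows "fls_has_sum (\<lambda>i. c * f i) A (c * s)"
proof -
  have s0: "fls_nth s n = 0" if "n < b" for n
  proof -
    have "((\<lambda>i. fls_nth (f i) n) has_sum 0) A"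
      using bound that by (intro has_sum_0) auto
    then show ?thesis using sum has_sum_unique unfolding fls_has_sum_def by blast
  qed
  \<comment> \<open>For all series vanishing below \<open>b\<close>, the convolution runs over one
    finite range that does not depend on the series. Summation therefore commutes with it.\<close>
  have prod: "fls_nth (c * g) n = (\<Sum>j=fls_subdegree c..n - b. fls_nth c j * fls_nth g (n - j))"
    if g: "\<And>n. n < b \<Longrightarrow> fls_nth g n = 0" for g :: "'m fls" and n
  proof (cases "g = 0")
    case False
    then have "b \<le> fls_subdegree g" using g fls_subdegree_geI by blast
    then show ?thesis
      unfolding fls_times_nth(2)
      by (intro sum.mono_neutral_left) auto
  qed simp
  show ?thesis
    unfolding fls_has_sum_def
  proof
    fix n
    have "((\<lambda>i. \<Sum>j=fls_subdegree c..n - b. fls_nth c j * fls_nth (f i) (n - j)) has_sum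
        (\<Sum>j=fls_subdegree c..n - b. fls_nth c j * fls_nth s (n - j))) A"
      using sum unfolding fls_has_sum_def
      by (intro has_sum_sum_finite has_sum_cmult_right) auto
    then show "((\<lambda>i. fls_nth (c * f i) n) has_sum fls_nth (c * s) n) A"
      using prod[OF s0] prod[OF bound] by (subst has_sum_cong[where g = "\<lambda>i. \<Sum>j=fls_subdegree c..n - b. fls_nth c j * fls_nth (f i) (n - j)"]) auto
  qed
qed

section \<open>The substitutions\<close>

lemma mcoeff_times [simp]: "mcoeff (x * y) = mcoeff x * mcoeff y"
  by (simp add: times_mono_def)

lemma mexpo_times [simp]: "mexpo (x * y) = mexpo x + mexpo y"
  by (simp add: times_mono_def)

lemma mcoeff_one [simp]: "mcoeff 1 = 1" and mexpo_one [simp]: "mexpo 1 = 0"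
  by (simp_all add: one_mono_def)

lemma mcoeff_power [simp]: "mcoeff (x ^ n) = mcoeff x ^ n"
  by (induction n) auto

fun scale :: "nat \<Rightarrow> expo \<Rightarrow> expo" where
  "scale n (k1, k2, k3, k4, k5) = (n * k1, n * k2, n * k3, n * k4, n * k5)"

lemma mexpo_power [simp]: "mexpo (x ^ n) = scale n (mexpo x)"
proof (induction n)
  case 0
  then show ?case by (cases "mexpo x") (simp add: zero_prod_def)
next
  case (Suc n)
  then show ?case by (cases "mexpo x") simp
qed

lemma mono_generators [simp]:
  "mcoeff (Const r) = r" "mexpo (Const r) = (0, 0, 0, 0, 0)"
  "mcoeff Va = 1" "mexpo Va = (1, 0, 0, 0, 0)"
  "mcoeff Vb = 1" "mexpo Vb = (0, 1, 0, 0, 0)"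
  "mcoeff Vc = 1" "mexpo Vc = (0, 0, 1, 0, 0)"
  "mcoeff Vd = 1" "mexpo Vd = (0, 0, 0, 1, 0)"
  "mcoeff Vf = 1" "mexpo Vf = (0, 0, 0, 0, 1)"
  by (simp_all add: Const_def Va_def Vb_def Vc_def Vd_def Vf_def zero_prod_def)

fun swap :: "expo \<Rightarrow> expo" where
  "swap (k1, k2, k3, k4, k5) = (k2, k1, k5, k4, k3)"

text \<open>The exponents of \<open>I(\<dots>, ab, b, cdf, df\<^sup>2, f)\<close>\<close>

fun up :: "expo \<Rightarrow> expo" where
  "up (k1, k2, k3, k4, k5) = (k1, k1 + k2, k3, k3 + k4, k3 + 2 * k4 + k5)"

text \<open>The exponents of the third term, where \<open>ab, 1, cdf, 1, 1\<close> are
  substituted.\<close>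

fun collapse :: "expo \<Rightarrow> expo" where
  "collapse (k1, k2, k3, k4, k5) = (k1, k1, k3, k3, k3)"

text \<open>Scalars enter only through what replaces a and c, hence the dependence on
  \<open>k1\<close> and \<open>k3\<close> alone.\<close>

fun mono_weight :: "'m::comm_ring_1 \<Rightarrow> expo \<Rightarrow> 'm fls" where
  "mono_weight c (k1, k2, k3, k4, k5) = weight c k1 k3"

lemma inj_up: "inj up"
  by (rule injI) (auto elim!: up.elims)

abbreviation "subst_a c \<equiv> Const (fls_X_inv * fls_const c) * Va * Vb"
abbreviation "subst_c \<equiv> Const fls_X * Vc * Vd * Vf"

lemma subst_first:
  "mcoeff (subst_mono (subst_a c) Vb subst_c (Vd * Vf ^ 2) Vf k) = mono_weight c k"
  "mexpo (subst_mono (subst_a c) Vb subst_c (Vd * Vf ^ 2) Vf k) = up k"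
  by (cases k; simp add: weight_def)+

lemma subst_second:
  "mcoeff (subst_mono (subst_a c) Va subst_c (Vd * Vc ^ 2) Vc k) = mono_weight c k"
  "mexpo (subst_mono (subst_a c) Va subst_c (Vd * Vc ^ 2) Vc k) = swap (up k)"
  by (cases k; simp add: weight_def)+

lemma subst_third:
  "mcoeff (subst_mono (subst_a c) 1 subst_c 1 1 k) = mono_weight c k"
  "mexpo (subst_mono (subst_a c) 1 subst_c 1 1 k) = collapse k"
  by (cases k; simp add: weight_def zero_prod_def)+

lemma subst_swap:
  "mcoeff (subst_mono Vb Va Vf Vd Vc k) = 1"
  "mexpo (subst_mono Vb Va Vf Vd Vc k) = swap k"
  by (cases k; simp)+

section \<open>Coefficients of the substituted series\<close>

lemma swap_eq_iff: "swap x = y \<longleftrightarrow> x = swap y"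
  by (cases x; cases y) auto

text \<open>The first term of the equation. Since \<open>up\<close> is injective, at most one
  monomial contributes to each exponent.\<close>

definition up_term :: "'m::comm_ring_1 \<Rightarrow> 'm fls series \<Rightarrow> 'm fls series" where
  "up_term c I e = (if e \<in> range up then mono_weight c (inv up e) * I (inv up e) else 0)"

lemma up_term_up [simp]: "up_term c I (up k) = mono_weight c k * I k"
  by (simp add: up_term_def inj_up)

lemma up_term_notin: "e \<notin> range up \<Longrightarrow> up_term c I e = 0"
  by (simp add: up_term_def)

lemma up_term_infsum:
  fixes I :: "'m::{comm_ring_1, topological_comm_monoid_add, t2_space} fls series"
  shows "fls_infsum (\<lambda>k. I k * mono_weight c k) {k. up k = e} = up_term c I e"
proof (cases "e \<in> range up")
  case True
  then obtain k where k: "e = up k" by blast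
  then have "{j. up j = e} = {k}" using inj_up by (auto dest: injD)
  then show ?thesis
    using k by (simp add: fls_infsumI[OF fls_has_sum_singleton] mult.commute)
next
  case False
  then have "{k. up k = e} = {}" by blast
  then show ?thesis
    using False by (simp only: fls_infsumI[OF fls_has_sum_empty] up_term_notin not_False_eq_True)
qed

lemma substitute_first:
  fixes I :: "'m::{comm_ring_1, topological_comm_monoid_add, t2_space} fls series"
  shows "substitute I (subst_a c) Vb subst_c (Vd * Vf ^ 2) Vf e = up_term c I e"
  unfolding substitute_def subst_first by (rule up_term_infsum)

lemma substitute_second:
  fixes I :: "'m::{comm_ring_1, topological_comm_monoid_add, t2_space} fls series"
  shows "substitute I (subst_a c) Va subst_c (Vd * Vc ^ 2) Vc e = up_term c I (swap e)"
  unfolding substitute_def subst_second swap_eq_iff by (rule up_term_infsum)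

text \<open>The monomials collapsing to \<open>(p, p, q, q, q)\<close> are those with
  \<open>k1 = p\<close> and \<open>k3 = q\<close>. They share one weight, which factors out of the
  sum.\<close>

lemma substitute_third:
  fixes I :: "'m::{comm_ring_1, topological_ab_group_add, topological_semigroup_mult, t2_space} fls series"
  assumes "fls_has_sum (\<lambda>(k2, k4, k5). I (p, k2, q, k4, k5)) UNIV s"
  shows "substitute I (subst_a c) 1 subst_c 1 1 (p, p, q, q, q) = weight c p q * s"
proof -
  let ?h = "\<lambda>(k2, k4, k5). (p, k2, q, k4, k5) :: expo"
  have "{k. collapse k = (p, p, q, q, q)} = range ?h"
    by (auto simp: image_iff)
  moreover have "inj ?h" by (auto simp: inj_def)
  moreover have "fls_has_sum (\<lambda>x. I (?h x) * mono_weight c (?h x)) UNIV (weight c p q * s)"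
  proof -
    have "(\<lambda>x. I (?h x) * mono_weight c (?h x)) = (\<lambda>x. weight c p q * I (?h x))"
      by (auto simp: fun_eq_iff mult.commute)
    moreover have "fls_has_sum (\<lambda>x. I (?h x)) UNIV s"
      using assms by (simp add: case_prod_unfold)
    ultimately show ?thesis
      using fls_has_sum_weight[of "\<lambda>x. I (?h x)" UNIV s c p q] by (simp only:)
  qed
  ultimately have "fls_has_sum (\<lambda>k. I k * mono_weight c k) {k. collapse k = (p, p, q, q, q)} (weight c p q * s)"
    by (simp only: fls_has_sum_reindex)
  then show ?thesis
    unfolding substitute_def subst_third by (rule fls_infsumI)
qed

lemma substitute_third_eq_0:
  fixes I :: "'m::{comm_ring_1, topological_comm_monoid_add, t2_space} fls series"
  assumes "\<not> (k1 = k2 \<and> k3 = k4 \<and> k4 = k5)"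
  shows "substitute I (subst_a c) 1 subst_c 1 1 (k1, k2, k3, k4, k5) = 0"
proof -
  have "{k. collapse k = (k1, k2, k3, k4, k5)} = {}"
    using assms by auto
  then show ?thesis
    unfolding substitute_def subst_third by (simp only: fls_infsumI[OF fls_has_sum_empty])
qed

lemma substitute_swap:
  fixes I :: "'m::{comm_ring_1, topological_comm_monoid_add, t2_space} fls series"
  shows "substitute I Vb Va Vf Vd Vc e = I (swap e)"
proof -
  have "{k. mexpo (subst_mono Vb Va Vf Vd Vc k) = e} = {swap e}"
    unfolding subst_swap swap_eq_iff by blast
  then show ?thesis
    unfolding substitute_def subst_swap by (simp add: fls_infsumI[OF fls_has_sum_singleton])
qed

section \<open>The equation as a recursion on coefficients\<close>

definition recursive_series :: "'m::{comm_ring_1, topological_space} \<Rightarrow> 'm \<Rightarrow> 'm fls series \<Rightarrow> bool" where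
  "recursive_series L c I \<longleftrightarrow>
     divisible_by_abcdf I \<and> (\<forall>e. I (swap e) = I e) \<and>
     (\<forall>k1 k2 k3 k4 k5. k1 < k2 \<longrightarrow> I (k1, k2, k3, k4, k5) = up_term c I (k1, k2, k3, k4, k5)) \<and>
     (\<forall>k1 k3 k4 k5. \<not> (k3 = k4 \<and> k4 = k5) \<longrightarrow> I (k1, k1, k3, k4, k5) = 0) \<and>
     (\<forall>p q. \<exists>s. fls_has_sum (\<lambda>(k2, k4, k5). I (p, k2, q, k4, k5)) UNIV s \<and>
        I (p, p, q, q, q) = (fls_const L - 1) * (weight c p q * s))"

text \<open>\<open>up\<close> adds \<open>k1\<close> to \<open>k2\<close>, so a preimage must have
  second exponent 0, where a divisible series vanishes.\<close>

lemma up_term_eq_0: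
  assumes "divisible_by_abcdf I" "k2 \<le> k1"
  shows "up_term c I (k1, k2, k3, k4, k5) = 0"
proof (cases "(k1, k2, k3, k4, k5) \<in> range up")
  case True
  then obtain j where j: "(k1, k2, k3, k4, k5) = up j" by blast
  obtain j1 j2 j3 j4 j5 where "j = (j1, j2, j3, j4, j5)" by (cases j)
  moreover from this j assms(2) have "j2 = 0" by simp
  ultimately have "I j = 0" using assms(1) unfolding divisible_by_abcdf_def by fastforce
  then show ?thesis unfolding j by simp
qed (rule up_term_notin)

text \<open>At each exponent at most one right-hand term survives. The second term is the first one
  at the swapped exponent, so symmetry reduces \<open>k1 > k2\<close> to \<open>k1 < k2\<close>. On
  the diagonal a single \<open>s\<close> witnesses both summability and the third term.\<close>

lemma solution_iff_recursive_series:
  fixes I :: "'m::{comm_ring_1, topological_ab_group_add, topological_semigroup_mult, t2_space} fls series"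
  shows "solution L c I \<longleftrightarrow> recursive_series L c I"
proof -
  have feq: "functional_equation L c I \<longleftrightarrow>
      (\<forall>e. I e = up_term c I e + up_term c I (swap e)
         + (fls_const L - 1) * substitute I (subst_a c) 1 subst_c 1 1 e)"
    unfolding functional_equation_def Let_def substitute_first substitute_second ..
  have sym: "symmetric I \<longleftrightarrow> (\<forall>e. I (swap e) = I e)"
    unfolding symmetric_def fun_eq_iff substitute_swap by metis
  show ?thesis
  proof
    assume sol: "solution L c I"
    then have div: "divisible_by_abcdf I" and summ: "summable_bdf I"
      and eq: "\<And>e. I e = up_term c I e + up_term c I (swap e)
         + (fls_const L - 1) * substitute I (subst_a c) 1 subst_c 1 1 e" and sw: "\<forall>e. I (swap e) = I e"
      unfolding solution_def feq sym by blast+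
    have "I (k1, k2, k3, k4, k5) = up_term c I (k1, k2, k3, k4, k5)" if "k1 < k2" for k1 k2 k3 k4 k5
      using eq[of "(k1, k2, k3, k4, k5)"] up_term_eq_0[OF div, of k1 k2] that
      by (simp add: substitute_third_eq_0)
    moreover have "I (k1, k1, k3, k4, k5) = 0" if "\<not> (k3 = k4 \<and> k4 = k5)" for k1 k3 k4 k5
      using eq[of "(k1, k1, k3, k4, k5)"] up_term_eq_0[OF div, of k1 k1] that
      by (simp add: substitute_third_eq_0)
    moreover have "\<exists>s. fls_has_sum (\<lambda>(k2, k4, k5). I (p, k2, q, k4, k5)) UNIV s \<and>
        I (p, p, q, q, q) = (fls_const L - 1) * (weight c p q * s)" for p q
    proof -
      obtain s where s: "fls_has_sum (\<lambda>(k2, k4, k5). I (p, k2, q, k4, k5)) UNIV s"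
        using summ unfolding summable_bdf_def by blast
      then show ?thesis
        using eq[of "(p, p, q, q, q)"] up_term_eq_0[OF div, of p p]
        by (auto simp: substitute_third[OF s])
    qed
    ultimately show "recursive_series L c I"
      unfolding recursive_series_def using div sw by blast
  next
    assume rec: "recursive_series L c I"
    then have div: "divisible_by_abcdf I" and sw: "\<And>e. I (swap e) = I e"
      and less: "\<And>k1 k2 k3 k4 k5. k1 < k2 \<Longrightarrow> I (k1, k2, k3, k4, k5) = up_term c I (k1, k2, k3, k4, k5)"
      and off: "\<And>k1 k3 k4 k5. \<not> (k3 = k4 \<and> k4 = k5) \<Longrightarrow> I (k1, k1, k3, k4, k5) = 0"
      and diag: "\<And>p q. \<exists>s. fls_has_sum (\<lambda>(k2, k4, k5). I (p, k2, q, k4, k5)) UNIV s \<and>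
        I (p, p, q, q, q) = (fls_const L - 1) * (weight c p q * s)"
      unfolding recursive_series_def by blast+
    have "I e = up_term c I e + up_term c I (swap e)
         + (fls_const L - 1) * substitute I (subst_a c) 1 subst_c 1 1 e" for e
    proof -
      obtain k1 k2 k3 k4 k5 where e: "e = (k1, k2, k3, k4, k5)" by (cases e)
      consider "k1 < k2" | "k2 < k1" | "k1 = k2" "\<not> (k3 = k4 \<and> k4 = k5)"
        | "k1 = k2" "k3 = k4" "k4 = k5" by linarith
      then show ?thesis
      proof cases
        case 1
        then show ?thesis unfolding e using less
          by (simp add: substitute_third_eq_0 up_term_eq_0[OF div])
      next
        case 2
        then show ?thesis unfolding e using less[of k2 k1 k5 k4 k3] sw[of e]
          by (simp add: substitute_third_eq_0 up_term_eq_0[OF div] e)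
      next
        case 3
        then show ?thesis unfolding e using off
          by (simp add: substitute_third_eq_0 up_term_eq_0[OF div])
      next
        case 4
        obtain s where s: "fls_has_sum (\<lambda>(j2, j4, j5). I (k1, j2, k3, j4, j5)) UNIV s"
          "I (k1, k1, k3, k3, k3) = (fls_const L - 1) * (weight c k1 k3 * s)"
          using diag by blast
        then show ?thesis unfolding e using 4 substitute_third[OF s(1)]
          by (simp add: up_term_eq_0[OF div])
      qed
    qed
    moreover have "summable_bdf I" unfolding summable_bdf_def using diag by blast
    ultimately show "solution L c I"
      unfolding solution_def feq sym using div sw by blast
  qed
qed

text \<open>Linearity reduces uniqueness to the vanishing of a solution whose coefficient at abcdf
  is 0.\<close>

lemma recursive_series_diff:
  fixes I J :: "'m::{comm_ring_1, topological_ab_group_add, topological_semigroup_mult, t2_space} fls series"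
  assumes "recursive_series L c I" "recursive_series L c J"
  shows "recursive_series L c (\<lambda>k. I k - J k)"
proof -
  have up: "up_term c (\<lambda>k. I k - J k) e = up_term c I e - up_term c J e" for e
    by (simp add: up_term_def algebra_simps)
  have "\<exists>s. fls_has_sum (\<lambda>(k2, k4, k5). I (p, k2, q, k4, k5) - J (p, k2, q, k4, k5)) UNIV s \<and>
        I (p, p, q, q, q) - J (p, p, q, q, q) = (fls_const L - 1) * (weight c p q * s)" for p q
  proof -
    obtain s s' where
      s: "fls_has_sum (\<lambda>(k2, k4, k5). I (p, k2, q, k4, k5)) UNIV s"
        "I (p, p, q, q, q) = (fls_const L - 1) * (weight c p q * s)" and
      s': "fls_has_sum (\<lambda>(k2, k4, k5). J (p, k2, q, k4, k5)) UNIV s'"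
        "J (p, p, q, q, q) = (fls_const L - 1) * (weight c p q * s')"
      using assms unfolding recursive_series_def by meson
    have "fls_has_sum (\<lambda>(k2, k4, k5). I (p, k2, q, k4, k5) - J (p, k2, q, k4, k5)) UNIV (s - s')"
      using fls_has_sum_diff[OF s(1) s'(1)] by (simp add: case_prod_unfold)
    then show ?thesis
      using s(2) s'(2) by (intro exI[of _ "s - s'"]) (simp add: right_diff_distrib)
  qed
  moreover have "divisible_by_abcdf (\<lambda>k. I k - J k)"
    using assms unfolding recursive_series_def divisible_by_abcdf_def by (metis diff_self)
  ultimately show ?thesis
    using assms unfolding recursive_series_def up by simp
qed

section \<open>Uniqueness\<close>

text \<open>The properties of \<bbbL> in the completed ring on which the argument rests:
  \<open>null\<close> serves uniqueness, \<open>geometric\<close> serves existence.\<close>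

locale lefschetz_inverse =
  fixes L L' :: "'m::{comm_ring_1, topological_ab_group_add, topological_semigroup_mult, t2_space}"
  assumes inverse: "L * L' = 1"
    and null: "(\<lambda>n. L' ^ n) \<longlonglongrightarrow> 0"
    and geometric: "\<exists>s. ((\<lambda>n. L' ^ n) has_sum s) UNIV"
begin

lemma L_power_cancel: "L ^ n * (L' ^ n * x) = x"
  by (metis inverse mult.assoc mult_1_left power_mult_distrib power_one)

text \<open>At the lowest nonzero coefficient, the right-hand side would look strictly below
  it.\<close>

lemma fls_eq_0_if_shift_eigenvector:
  fixes S :: "'m fls"
  assumes "\<And>n. fls_nth S n = z * fls_nth S (n - d)" "d > 0"
  shows "S = 0"
proof (rule ccontr)
  assume "S \<noteq> 0"
  then have "fls_nth S (fls_subdegree S) \<noteq> 0" by simp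
  then show False using assms(1)[of "fls_subdegree S"] assms(2) by simp
qed

text \<open>Comparing coefficients gives \<open>S_n = y S_(n+P-q)\<close> with
  \<open>y = L' ^ (P - 1)\<close>. The excluded pair \<open>P = q = 1\<close> is where this reads
  \<open>S_n = S_n\<close>; it leaves one coefficient of a solution free.\<close>

lemma weight_eigenvector_eq_0:
  assumes S: "S = fls_const L * (weight L' P q * S)" and "P \<ge> 1" "\<not> (P = 1 \<and> q = 1)"
  shows "S = 0"
proof -
  define y where "y = L' ^ (P - 1)"
  have "L * L' ^ P = y"
    using \<open>P \<ge> 1\<close> inverse unfolding y_def
    by (cases P) (auto simp: mult.assoc[symmetric])
  then have eq: "fls_nth S n = y * fls_nth S (n + int P - int q)" for n
    by (subst S) (metis fls_mult_const_nth(1) weight_times_nth mult.assoc)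
  consider "q > P" | "q < P" | "q = P" by linarith
  then show ?thesis
  proof cases
    case 1
    have "n + int P - int q = n - (int q - int P)" for n by simp
    then have "fls_nth S n = y * fls_nth S (n - (int q - int P))" for n using eq[of n] by metis
    then show ?thesis by (rule fls_eq_0_if_shift_eigenvector) (use 1 in simp)
  next
    case 2
    \<comment> \<open>Here the relation looks upwards. Since \<open>y\<close> is invertible, it can
      be solved for the higher coefficient.\<close>
    have "fls_nth S n = L ^ (P - 1) * fls_nth S (n - (int P - int q))" for n
    proof -
      have "n - (int P - int q) + int P - int q = n" by simp
      then have "fls_nth S (n - (int P - int q)) = y * fls_nth S n"
        using eq[of "n - (int P - int q)"] by metis
      then show ?thesis by (simp only: y_def L_power_cancel)
    qed
    then show ?thesis by (rule fls_eq_0_if_shift_eigenvector) (use 2 in simp)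
  next
    case 3
    have "fls_nth S n = 0" for n
    proof -
      have iter: "fls_nth S n = y ^ j * fls_nth S n" for j
      proof (induction j)
        case (Suc j)
        have "fls_nth S n = y * fls_nth S n" using eq[of n] 3 by (metis add_diff_cancel_right')
        then show ?case using Suc by (metis power_Suc2 mult.assoc)
      qed simp
      \<comment> \<open>Now \<open>P\<close> is at least 2, so the powers of \<open>y\<close> form a
        subsequence of the null sequence of powers of \<open>L'\<close>.\<close>
      have "strict_mono (\<lambda>j. (P - 1) * j)"
        using assms 3 by (intro strict_monoI) auto
      from LIMSEQ_subseq_LIMSEQ[OF null this] have "(\<lambda>j. y ^ j) \<longlonglongrightarrow> 0"
        by (simp add: y_def o_def power_mult)
      then have "(\<lambda>j. y ^ j * fls_nth S n) \<longlonglongrightarrow> 0 * fls_nth S n"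
        by (intro tendsto_intros)
      then have "(\<lambda>j. fls_nth S n) \<longlonglongrightarrow> 0" by (simp add: iter[symmetric])
      then show ?thesis using LIMSEQ_unique tendsto_const by blast
    qed
    then show ?thesis by (intro fls_eqI) simp
  qed
qed

section \<open>Vanishing of solutions with zero coefficient at abcdf\<close>

lemma fls_has_sum_up_term:
  assumes "fls_has_sum (\<lambda>(k2, k4, k5). J (p, k2, q, k4, k5)) UNIV s"
  shows "fls_has_sum (\<lambda>(k2, k4, k5). up_term L' J (p, k2, q, k4, k5)) UNIV (weight L' p q * s)"
proof -
  let ?f = "\<lambda>(k2, k4, k5). up_term L' J (p, k2, q, k4, k5)"
  define \<phi> where "\<phi> = (\<lambda>(k2, k4, k5). (p + k2, q + k4, q + 2 * k4 + k5))"
  \<comment> \<open>\<open>up\<close> fixes \<open>k1\<close> and \<open>k3\<close>; \<phi> is its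
    restriction to the slice with these exponents equal to \<open>p\<close> and \<open>q\<close>, on
    which the weight is constant.\<close>
  have inj: "inj \<phi>" by (auto simp: inj_def \<phi>_def)
  have "?f (\<phi> x) = weight L' p q * (case x of (k2, k4, k5) \<Rightarrow> J (p, k2, q, k4, k5))" for x
  proof -
    obtain k2 k4 k5 where x: "x = (k2, k4, k5)" by (cases x)
    show ?thesis using up_term_up[of L' J "(p, k2, q, k4, k5)"] by (simp add: x \<phi>_def)
  qed
  then have "fls_has_sum (\<lambda>x. ?f (\<phi> x)) UNIV (weight L' p q * s)"
    using fls_has_sum_weight[OF assms, of L' p q] by presburger
  then have "fls_has_sum ?f (range \<phi>) (weight L' p q * s)"
    by (subst fls_has_sum_reindex[OF inj])
  moreover have "?f x = 0" if "x \<notin> range \<phi>" for x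
  proof -
    obtain k2 k4 k5 where x: "x = (k2, k4, k5)" by (cases x)
    have "(p, k2, q, k4, k5) \<notin> range up"
      using that by (auto simp: x \<phi>_def image_iff)
    then show ?thesis by (simp add: x up_term_notin del: up.simps)
  qed
  ultimately show ?thesis
    by (subst (asm) fls_has_sum_cong_neutral[where T = UNIV and g = ?f]) auto
qed

text \<open>Strong induction on \<open>gcd k1 k2\<close>: the diagonal coefficients for the current
  gcd vanish by the eigenvector equation, and the others follow by the Euclidean algorithm.\<close>

lemma recursive_series_eq_0:
  assumes rec: "recursive_series L L' J" and J1: "J (1, 1, 1, 1, 1) = 0"
  shows "J k = 0"
proof -
  have div: "J (k1, k2, k3, k4, k5) = 0" if "k1 = 0 \<or> k2 = 0" for k1 k2 k3 k4 k5
    using rec that unfolding recursive_series_def divisible_by_abcdf_def by fastforce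
  have div': "divisible_by_abcdf J" and sw: "\<And>e. J (swap e) = J e"
    and up_eq: "\<And>k1 k2 k3 k4 k5. k1 < k2 \<Longrightarrow> J (k1, k2, k3, k4, k5) = up_term L' J (k1, k2, k3, k4, k5)"
    and off: "\<And>k1 k3 k4 k5. \<not> (k3 = k4 \<and> k4 = k5) \<Longrightarrow> J (k1, k1, k3, k4, k5) = 0"
    and diag: "\<And>p q. \<exists>s. fls_has_sum (\<lambda>(k2, k4, k5). J (p, k2, q, k4, k5)) UNIV s \<and>
        J (p, p, q, q, q) = (fls_const L - 1) * (weight L' p q * s)"
    using rec unfolding recursive_series_def by blast+
  have euclid: "J (k1, k2, k3, k4, k5) = 0"
    if "\<And>q. J (P, P, q, q, q) = 0" "gcd k1 k2 = P" for P k1 k2 k3 k4 k5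
    using that(2)
  proof (induction "k1 + k2" arbitrary: k1 k2 k3 k4 k5 rule: less_induct)
    case less
    \<comment> \<open>Stated for fresh exponents, so that the case \<open>k2 < k1\<close> can use it
      after a swap.\<close>
    have lt: "J (k1, k2, k3, k4, k5) = 0"
      if lt: "k1 < k2" "gcd k1 k2 = P" "k1 + k2 = m"
        and IH: "\<And>j1 j2 j3 j4 j5. j1 + j2 < m \<Longrightarrow> gcd j1 j2 = P \<Longrightarrow> J (j1, j2, j3, j4, j5) = 0"
      for k1 k2 k3 k4 k5 m
    \<comment> \<open>Passing from \<open>(k1, k2)\<close> to \<open>(k1, k2 - k1)\<close> keeps the
      gcd; \<open>k1 > 0\<close> makes the sum strictly smaller.\<close>
    proof (cases "k1 > 0 \<and> (k1, k2, k3, k4, k5) \<in> range up")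
      case True
      then obtain j where j: "(k1, k2, k3, k4, k5) = up j" by blast
      obtain j1 j2 j3 j4 j5 where j': "j = (j1, j2, j3, j4, j5)" by (cases j)
      have "j1 = k1" "k2 = k1 + j2" using j j' by auto
      then have "J j = 0" unfolding j' using True lt by (intro IH) auto
      then show ?thesis using up_eq[OF lt(1), of k3 k4 k5]
        unfolding j up_term_up by simp
    next
      case False
      then show ?thesis using div up_term_notin up_eq[OF lt(1), of k3 k4 k5]
        by (metis gr_zeroI)
    qed
    consider "k1 < k2" | "k2 < k1" | "k1 = k2" by linarith
    then show ?case
    proof cases
      case 1
      then show ?thesis using lt[OF 1 less.prems refl] less.hyps by blast
    next
      case 2
      have "J (k2, k1, k5, k4, k3) = 0"
        using lt[OF 2, of "k1 + k2"] less.hyps less.prems by (simp add: gcd.commute add.commute)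
      then show ?thesis using sw[of "(k1, k2, k3, k4, k5)"] by simp
    next
      case 3
      then show ?thesis using less.prems off that(1) by (cases "k3 = k4 \<and> k4 = k5") auto
    qed
  qed
  have "\<forall>k1 k2 k3 k4 k5. gcd k1 k2 = P \<longrightarrow> J (k1, k2, k3, k4, k5) = 0" for P
  proof (induction P rule: less_induct)
    case IH: (less P)
    have "J (P, P, q, q, q) = 0" for q
    proof (cases "P = 0 \<or> (P = 1 \<and> q = 1)")
      case True
      then show ?thesis using J1 div by auto
    next
      case False
      define x where "x = J (P, P, q, q, q)"
      obtain S where S: "fls_has_sum (\<lambda>(k2, k4, k5). J (P, k2, q, k4, k5)) UNIV S"
        and x: "x = (fls_const L - 1) * (weight L' P q * S)"
        using diag x_def by blast
      let ?pt = "\<lambda>i. if i = (P, q, q) then x else 0"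
      have pt: "fls_has_sum ?pt UNIV x"
        using fls_has_sum_singleton[of ?pt "(P, q, q)"]
        by (subst fls_has_sum_cong_neutral[where T = "{(P, q, q)}" and g = ?pt]) auto
      \<comment> \<open>For \<open>0 < k2 < P\<close> the gcd is smaller than \<open>P\<close> and
        the induction hypothesis applies; at \<open>k2 = P\<close> only the diagonal entry
        \<open>x\<close> can survive; for \<open>k2 > P\<close> the recursion applies.\<close>
      have split: "J (P, k2, q, k4, k5) = ?pt (k2, k4, k5) + up_term L' J (P, k2, q, k4, k5)"
        for k2 k4 k5
      proof -
        consider "k2 < P" | "k2 = P" | "P < k2" by linarith
        then show ?thesis
        proof cases
          case 1
          have "J (P, k2, q, k4, k5) = 0"
          proof (cases "k2 = 0")
            case False
            then have "gcd P k2 < P" using 1 gcd_le2_nat[of k2 P] by linarith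
            then show ?thesis using IH by blast
          qed (simp add: div)
          then show ?thesis using 1 by (simp add: up_term_eq_0[OF div'])
        next
          case 2
          then show ?thesis using off[of q k4 k5 P] by (auto simp: up_term_eq_0[OF div'] x_def)
        next
          case 3
          then show ?thesis using up_eq by simp
        qed
      qed
      have "(\<lambda>(k2, k4, k5). J (P, k2, q, k4, k5))
          = (\<lambda>i. ?pt i + (case i of (k2, k4, k5) \<Rightarrow> up_term L' J (P, k2, q, k4, k5)))"
      proof
        fix i :: "nat \<times> nat \<times> nat"
        obtain k2 k4 k5 where "i = (k2, k4, k5)" by (cases i)
        then show "(case i of (k2, k4, k5) \<Rightarrow> J (P, k2, q, k4, k5))
          = ?pt i + (case i of (k2, k4, k5) \<Rightarrow> up_term L' J (P, k2, q, k4, k5))"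
          using split[of k2 k4 k5] by (simp only: case_prod_conv)
      qed
      then have "fls_has_sum (\<lambda>(k2, k4, k5). J (P, k2, q, k4, k5)) UNIV (x + weight L' P q * S)"
        using fls_has_sum_add[OF pt fls_has_sum_up_term[OF S]] by (simp only:)
      then have "S = x + weight L' P q * S" using S fls_has_sum_unique by blast
      also have "\<dots> = fls_const L * (weight L' P q * S)" unfolding x by (simp add: algebra_simps)
      finally have "S = 0" using weight_eigenvector_eq_0 False by (metis One_nat_def Suc_leI gr_zeroI)
      then show ?thesis using x x_def by simp
    qed
    then show ?case using euclid by blast
  qed
  then show ?thesis by (cases k) blast
qed

text \<open>The full sum satisfies \<open>s = 1 + L' s\<close>, so \<open>r = L' s\<close> is
  inverse to \<open>L - 1\<close>. This is the diagonal equation for \<open>p = 1\<close>.\<close>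

lemma geometric_from_1:
  "\<exists>r. ((\<lambda>n. L' ^ n) has_sum r) {1..} \<and> (L - 1) * r = 1"
proof -
  obtain s where s: "((\<lambda>n. L' ^ n) has_sum s) UNIV" using geometric by blast
  have "((\<lambda>n. L' ^ n) has_sum (L' * s)) (range Suc)"
    using has_sum_cmult_right[OF s, of L'] by (subst has_sum_reindex) (auto simp: o_def)
  moreover have ran: "range Suc = {1..}" by (auto simp: image_iff) presburger
  ultimately have s1: "((\<lambda>n. L' ^ n) has_sum (L' * s)) {1..}" by simp
  have "((\<lambda>n. L' ^ n) has_sum (L' ^ 0 + L' * s)) (insert 0 {1..})"
    using s1 by (intro has_sum_insert) auto
  moreover have "insert 0 {1..} = (UNIV :: nat set)" by auto
  ultimately have "s = 1 + L' * s" using s has_sum_unique by fastforce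
  moreover have "L * (L' * s) = s" using inverse by (simp add: mult.assoc[symmetric])
  ultimately have "(L - 1) * (L' * s) = 1" by (simp add: left_diff_distrib) (metis add_diff_cancel_right')
  then show ?thesis using s1 by blast
qed

end

section \<open>Existence\<close>

text \<open>The coefficient of \<open>t^N\<close> in \<open>H p\<close>, with the normalisation
  \<open>H 1 = 1\<close>. For \<open>p \<ge> 2\<close> every \<open>n \<ge> 1\<close> lowers
  \<open>N\<close> by \<open>(p - 1) * n > 0\<close>. The value at \<open>p = 0\<close> is a
  default: the recursion from \<open>p \<ge> 2\<close> only reaches positive gcds.\<close>

function diag_coeff :: "'m::comm_ring_1 \<Rightarrow> 'm \<Rightarrow> nat \<Rightarrow> nat \<Rightarrow> 'm" where
  "diag_coeff L c p N = (if p \<le> 1 then (if N = 0 then 1 else 0)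
     else (L - 1) * (\<Sum>n\<in>{n \<in> {1..N}. (p - 1) * n \<le> N}. c ^ n * diag_coeff L c (gcd p n) (N - (p - 1) * n)))"
  by auto
termination
  by (relation "Wellfounded.measure (\<lambda>(L, c, p, N). N)") auto

declare diag_coeff.simps [simp del]

context lefschetz_inverse
begin

definition diag_series :: "nat \<Rightarrow> 'm fls" where
  "diag_series p = fps_to_fls (Abs_fps (diag_coeff L L' p))"

lemma diag_series_1: "diag_series 1 = 1"
  by (rule fls_eqI) (auto simp: diag_series_def diag_coeff.simps)

text \<open>For \<open>p = 1\<close> no power of t separates the summands and the geometric series
  is needed; for \<open>p \<ge> 2\<close> each coefficient in t is a finite sum.\<close>

lemma diag_series_sum:
  assumes "p \<ge> 1"
  shows "\<exists>r. fls_has_sum (\<lambda>n. weight L' n (p * n) * diag_series (gcd p n)) {1..} r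
           \<and> diag_series p = (fls_const L - 1) * r"
proof (cases "p = 1")
  case True
  obtain r where r: "((\<lambda>n. L' ^ n) has_sum r) {1..}" "(L - 1) * r = 1"
    using geometric_from_1 by blast
  have "fls_has_sum (\<lambda>n. weight L' n n * 1) {1..} (fls_const r)"
    unfolding fls_has_sum_def weight_times_nth using r(1) by simp
  moreover have "(fls_const L - 1) * fls_const r = 1"
    using r(2) by (intro fls_eqI) (simp add: left_diff_distrib)
  ultimately show ?thesis using True diag_series_1 by auto
next
  case False
  then have p: "p \<ge> 2" using assms by simp
  let ?A = "\<lambda>N. {n \<in> {1..N}. (p - 1) * n \<le> N}"
  define r where "r = fps_to_fls (Abs_fps (\<lambda>N. \<Sum>n\<in>?A N. L' ^ n * diag_coeff L L' (gcd p n) (N - (p - 1) * n)))"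
  have nth: "fls_nth (weight L' n (p * n) * diag_series (gcd p n)) N =
      (if N < int ((p - 1) * n) then 0
       else L' ^ n * diag_coeff L L' (gcd p n) (nat N - (p - 1) * n))" for n N
  proof -
    have shift: "N + int n - int (p * n) = N - int ((p - 1) * n)"
      using p by (cases p) (auto simp: algebra_simps)
    have "nat (N - int k) = nat N - k" for k by linarith
    then show ?thesis
      unfolding weight_times_nth shift diag_series_def fps_to_fls_nth by (simp del: of_nat_mult)
  qed
  have "fls_has_sum (\<lambda>n. weight L' n (p * n) * diag_series (gcd p n)) {1..} r"
    unfolding fls_has_sum_def
  proof
    fix N
    \<comment> \<open>Hence the cut-off \<open>n \<le> N\<close> in \<open>diag_coeff\<close> loses
      no summand.\<close>
    have le: "n \<le> (p - 1) * n" for n using p by (cases p) auto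
    show "((\<lambda>n. fls_nth (weight L' n (p * n) * diag_series (gcd p n)) N) has_sum fls_nth r N) {1..}"
    proof (cases "N < 0")
      case True
      have "N < int ((p - 1) * n)" for n using True by linarith
      then show ?thesis
        unfolding nth using True by (simp add: r_def has_sum_0)
    next
      case False
      have "((\<lambda>n. fls_nth (weight L' n (p * n) * diag_series (gcd p n)) N) has_sum
          (\<Sum>n\<in>?A (nat N). fls_nth (weight L' n (p * n) * diag_series (gcd p n)) N)) {1..}"
      proof (rule has_sum_finite_neutralI)
        fix n assume "n \<in> {1..} - ?A (nat N)"
        then have "\<not> (p - 1) * n \<le> nat N"
          using order.trans[OF le, of n "nat N"] by fastforce
        then show "fls_nth (weight L' n (p * n) * diag_series (gcd p n)) N = 0"
          unfolding nth by (simp del: of_nat_mult)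
      qed auto
      moreover have "(\<Sum>n\<in>?A (nat N). fls_nth (weight L' n (p * n) * diag_series (gcd p n)) N) = fls_nth r N"
        using False unfolding r_def fps_to_fls_nth
        by (simp, intro sum.cong refl) (auto simp: nth simp del: of_nat_mult)
      ultimately show ?thesis by simp
    qed
  qed
  moreover have "diag_series p = (fls_const L - 1) * r"
  proof (rule fls_eqI)
    fix N
    show "fls_nth (diag_series p) N = fls_nth ((fls_const L - 1) * r) N"
      using p diag_coeff.simps[of L L' p "nat N"]
      by (simp add: diag_series_def r_def left_diff_distrib)
  qed
  ultimately show ?thesis by blast
qed

section \<open>The solution \<open>I_0\<close>\<close>

fun basic_series :: "'m fls series" where
  "basic_series (k1, k2, k3, k4, k5) =
     (if k1 \<ge> 1 \<and> k2 \<ge> 1 \<and> k3 = k1 * k1 \<and> k4 = k1 * k2 \<and> k5 = k2 * k2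
      then weight L' (k1 + k2) (k1 * k2) * diag_series (gcd k1 k2) else 0)"

lemma basic_series_swap: "basic_series (swap e) = basic_series e"
proof -
  obtain k1 k2 k3 k4 k5 where e: "e = (k1, k2, k3, k4, k5)" by (cases e)
  show ?thesis
    unfolding e swap.simps basic_series.simps gcd.commute[of k2 k1] mult.commute[of k2 k1] add.commute[of k2 k1]
    by (simp only: conj_ac)
qed

text \<open>\<open>up\<close> sends \<open>(m, n, m^2, m n, n^2)\<close> to the same pattern for
  \<open>(m, m + n)\<close>, so it preserves the support. For \<open>k2 = 0\<close> it would land on
  the diagonal, which the third term governs.\<close>

lemma basic_series_up:
  assumes "k2 \<ge> 1"
  shows "basic_series (up (k1, k2, k3, k4, k5)) = weight L' k1 k3 * basic_series (k1, k2, k3, k4, k5)"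
proof -
  have "k3 = k1 * k1 \<and> k3 + k4 = k1 * (k1 + k2) \<and> k3 + 2 * k4 + k5 = (k1 + k2) * (k1 + k2)
      \<longleftrightarrow> k3 = k1 * k1 \<and> k4 = k1 * k2 \<and> k5 = k2 * k2"
    by (auto simp: algebra_simps)
  moreover have "weight L' (k1 + (k1 + k2)) (k1 * (k1 + k2))
      = weight L' k1 (k1 * k1) * weight L' (k1 + k2) (k1 * k2)"
    by (simp add: weight_mult distrib_left)
  moreover have "gcd k1 (k1 + k2) = gcd k1 k2" by simp
  ultimately show ?thesis
    using assms unfolding up.simps basic_series.simps by (auto simp only: mult.assoc mult_zero_right split: if_splits)
qed

lemma basic_series_less:
  assumes "k1 < k2"
  shows "basic_series (k1, k2, k3, k4, k5) = up_term L' basic_series (k1, k2, k3, k4, k5)"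
proof (cases "(k1, k2, k3, k4, k5) \<in> range up")
  case True
  then obtain j where j: "(k1, k2, k3, k4, k5) = up j" by blast
  obtain j1 j2 j3 j4 j5 where j': "j = (j1, j2, j3, j4, j5)" by (cases j)
  have "j2 \<ge> 1" using j j' assms by simp
  then show ?thesis
    unfolding j up_term_up using basic_series_up[of j2 j1 j3 j4 j5] by (simp add: j' del: up.simps)
next
  case False
  have "basic_series (k1, k2, k3, k4, k5) = 0"
  proof (rule ccontr)
    assume "basic_series (k1, k2, k3, k4, k5) \<noteq> 0"
    then have k: "k3 = k1 * k1" "k4 = k1 * k2" "k5 = k2 * k2" by (auto split: if_splits)
    obtain d where "k2 = k1 + d" using assms less_imp_add_positive by blast
    then have "(k1, k2, k3, k4, k5) = up (k1, d, k1 * k1, k1 * d, d * d)"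
      unfolding k by (simp add: algebra_simps)
    then show False using False by blast
  qed
  then show ?thesis using False by (simp add: up_term_notin del: up.simps)
qed

text \<open>The factor \<open>lam\<close> is carried along because multiples of \<open>I_0\<close>
  must be shown summable too, and this uses a common bound on poles.\<close>

lemma basic_series_sum:
  "\<exists>s. fls_has_sum (\<lambda>(k2, k4, k5). lam * basic_series (p, k2, q, k4, k5)) UNIV s \<and>
     lam * basic_series (p, p, q, q, q) = (fls_const L - 1) * (weight L' p q * s)"
proof (cases "p \<ge> 1 \<and> q = p * p")
  case False
  then have "fls_has_sum (\<lambda>(k2, k4, k5). lam * basic_series (p, k2, q, k4, k5)) UNIV 0"
    unfolding fls_has_sum_def by (auto intro!: has_sum_0)
  then show ?thesis using False by (intro exI[of _ 0]) auto
next
  case True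
  then have p: "p \<ge> 1" and q: "q = p * p" by auto
  let ?t = "\<lambda>n. weight L' n (p * n) * diag_series (gcd p n)"
  obtain r where r: "fls_has_sum ?t {1..} r" "diag_series p = (fls_const L - 1) * r"
    using diag_series_sum[OF p] by blast
  let ?f = "\<lambda>(k2, k4, k5). lam * basic_series (p, k2, q, k4, k5)"
  let ?h = "\<lambda>n::nat. (n, p * n, n * n)"
  \<comment> \<open>The exponent of t in the weight is \<open>p n - n \<ge> 0\<close>, so the
    summands are power series and 0 is a common bound.\<close>
  have "fls_nth (?t n) N = 0" if "N < 0" for n N
  proof -
    have "n \<le> p * n" using p by (cases p) auto
    then have "int n \<le> int (p * n)" by (simp only: of_nat_le_iff)
    then have "N + int n - int (p * n) < 0" using that by linarith
    then show ?thesis unfolding weight_times_nth diag_series_def fps_to_fls_nth by (simp only: if_True mult_zero_right)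
  qed
  then have "fls_has_sum (\<lambda>n. weight L' p 0 * (lam * ?t n)) {1..} (weight L' p 0 * (lam * r))"
    using r(1) by (intro fls_has_sum_weight fls_has_sum_cmult)
  \<comment> \<open>The slice meets the support only in the points \<open>?h n\<close>, and
    \<open>weight L' (p + n) (p * n)\<close> splits off the factor
    \<open>weight L' p 0\<close>.\<close>
  moreover have "weight L' p 0 * (lam * ?t n) = ?f (?h n)" if "n \<in> {1..}" for n
  proof -
    have "weight L' p 0 * (lam * ?t n) = lam * ((weight L' p 0 * weight L' n (p * n)) * diag_series (gcd p n))"
      by (simp only: ac_simps)
    then show ?thesis using that p q by (simp add: weight_mult)
  qed
  ultimately have "fls_has_sum (\<lambda>n. ?f (?h n)) {1..} (weight L' p 0 * (lam * r))"
    by (subst fls_has_sum_cong_neutral[where T = "{1..}" and g = "\<lambda>n. weight L' p 0 * (lam * ?t n)"]) auto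
  moreover have "inj_on ?h {1..}" by (auto simp: inj_on_def)
  ultimately have "fls_has_sum ?f (?h ` {1..}) (weight L' p 0 * (lam * r))"
    by (simp only: fls_has_sum_reindex)
  moreover have "?f x = 0" if "x \<notin> ?h ` {1..}" for x
    using that by (cases x) (auto simp: image_iff)
  ultimately have "fls_has_sum ?f UNIV (weight L' p 0 * (lam * r))"
    by (subst (asm) fls_has_sum_cong_neutral[where T = UNIV and g = ?f]) auto
  moreover have "lam * basic_series (p, p, q, q, q)
      = (fls_const L - 1) * (weight L' p q * (weight L' p 0 * (lam * r)))"
  proof -
    have "(fls_const L - 1) * (weight L' p q * (weight L' p 0 * (lam * r)))
        = lam * ((weight L' p q * weight L' p 0) * ((fls_const L - 1) * r))"
      by (simp only: ac_simps)
    then show ?thesis using p q r(2) by (simp add: weight_mult)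
  qed
  ultimately show ?thesis by blast
qed

lemma recursive_series_basic: "recursive_series L L' (\<lambda>k. lam * basic_series k)"
proof -
  have "up_term L' (\<lambda>k. lam * basic_series k) e = lam * up_term L' basic_series e" for e
    by (simp add: up_term_def mult.left_commute)
  moreover have "divisible_by_abcdf (\<lambda>k. lam * basic_series k)"
    by (auto simp: divisible_by_abcdf_def split: if_splits)
  moreover have "basic_series (k1, k1, k3, k4, k5) = 0" if "\<not> (k3 = k4 \<and> k4 = k5)" for k1 k3 k4 k5
    using that by auto
  ultimately show ?thesis
    unfolding recursive_series_def
    using basic_series_swap basic_series_less basic_series_sum by (simp del: basic_series.simps)
qed

lemma solutions_multiples_of_basic_series:
  "solution L L' basic_series"
  "solution L L' I \<Longrightarrow> \<exists>c. \<forall>k. I k = c * basic_series k"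
proof -
  show "solution L L' basic_series"
    using recursive_series_basic[of 1] by (simp add: solution_iff_recursive_series)
  assume "solution L L' I"
  then have I: "recursive_series L L' I" by (simp add: solution_iff_recursive_series)
  \<comment> \<open>The coefficient of \<open>I_0\<close> at abcdf is \<open>t^(-1) L^(-2)\<close>,
    a unit with inverse \<open>u\<close>; hence \<open>c\<close> matches the coefficients of
    \<open>I\<close> and \<open>c I_0\<close> there.\<close>
  define u where "u = fls_X * fls_const (L ^ 2)"
  have "u * weight L' 2 1 = fls_X * fls_X_inv * (fls_X * fls_X_inv) * fls_const (L ^ 2 * L' ^ 2)"
    by (simp add: u_def weight_def power2_eq_square ac_simps)
  also have "\<dots> = 1"
    using inverse by (simp add: fls_X_times_conv_shift(1) fls_X_inv_times_conv_shift flip: power_mult_distrib)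
  finally have u: "u * basic_series (1, 1, 1, 1, 1) = 1"
    using diag_series_1 by (simp add: numeral_2_eq_2)
  define c where "c = I (1, 1, 1, 1, 1) * u"
  have "recursive_series L L' (\<lambda>k. I k - c * basic_series k)"
    by (intro recursive_series_diff I recursive_series_basic)
  moreover have "I (1, 1, 1, 1, 1) - c * basic_series (1, 1, 1, 1, 1) = 0"
    using u by (simp add: c_def mult.assoc del: basic_series.simps)
  ultimately have "I k - c * basic_series k = 0" for k
    by (rule recursive_series_eq_0)
  then show "\<exists>c. \<forall>k. I k = c * basic_series k" by auto
qed

end

section \<open>The completed Grothendieck ring\<close>

lemma loc_of_point: "loc_of (k0_class point_var) = 1"
proof -
  have "gen point_var - 1 \<in> k0_relators" by (simp add: k0_relators_def)
  then have "0 + 1 * (gen point_var - 1) \<in> ideal_closure k0_relators"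
    by (intro ideal_closure.intros)
  then have "k0_class point_var = 1"
    by (simp add: k0_class.abs_eq one_k0.abs_eq k0.abs_eq_iff k0_eq_def)
  then show ?thesis by (simp add: loc_of_def one_k0_loc.abs_eq)
qed

text \<open>The power is the class of the point times \<open>L^(-n)\<close>, a generator of the
  filtration. As \<open>var_dim point_var\<close> is a fixed number, each step contains all high
  powers.\<close>

lemma LL_inv_power_in_filtration:
  assumes "int n \<ge> k + int (var_dim point_var)"
  shows "LL_inv ^ n \<in> motivic_filtration k"
proof -
  have "LL_inv ^ n = LL_powi (- int n)"
    by (cases "n = 0") (auto simp: LL_powi_def)
  then have "LL_inv ^ n = loc_of (k0_class point_var) * LL_powi (- int n)"
    by (simp add: loc_of_point)
  then show ?thesis
    using assms unfolding motivic_filtration_def by (intro group_closure.base) force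
qed

text \<open>High powers of \<open>LL_inv\<close> lie in every filtration step, and the steps are
  groups. So the powers tend to 0 and the partial sums are Cauchy.\<close>

lemma lefschetz_inverse_completion:
  fixes \<iota> :: "k0_loc \<Rightarrow> 'm::{comm_ring_1, topological_ab_group_add, topological_semigroup_mult, t2_space}"
  assumes "filtration_completion motivic_filtration \<iota>"
  shows "lefschetz_inverse (\<iota> LL) (\<iota> LL_inv)"
proof -
  interpret filtration_completion motivic_filtration \<iota> by fact
  define F where "F = motivic_filtration"
  define x where "x = LL_inv"
  have add0: "\<iota> 0 = 0" using hom_add[of 0 0] by simp
  have pow: "\<iota> x ^ n = \<iota> (x ^ n)" for n
    by (induction n) (simp_all add: hom_one hom_mult)
  have sum: "sum (\<lambda>n. \<iota> x ^ n) A = \<iota> (sum (\<lambda>n. x ^ n) A)" if "finite A" for A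
    using that by (induction A rule: finite_induct) (simp_all add: add0 hom_add pow)
  have diff: "\<iota> a - \<iota> b = \<iota> (a - b)" for a b
    using hom_add[of "a - b" b] by (simp add: algebra_simps)
  have F_diff: "a - b \<in> F k" if "a \<in> F k" "b \<in> F k" for a b k
    using that unfolding F_def motivic_filtration_def by (rule group_closure.diff)
  have F_0: "0 \<in> F k" for k
    unfolding F_def motivic_filtration_def by simp
  have F_sum: "sum (\<lambda>n. x ^ n) A \<in> F k" if "finite A" "\<And>n. n \<in> A \<Longrightarrow> x ^ n \<in> F k" for A k
    using that
  proof (induction A rule: finite_induct)
    case (insert n A)
    then have "x ^ n - (0 - sum (\<lambda>n. x ^ n) A) \<in> F k" by (intro F_diff F_0) auto
    then show ?case using insert by simp
  qed (simp add: F_0)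
  have ev: "\<exists>N. \<forall>n\<ge>N. x ^ n \<in> F k" for k
  proof -
    have "x ^ n \<in> F k" if "n \<ge> nat (k + int (var_dim point_var))" for n
      using that LL_inv_power_in_filtration unfolding x_def F_def by auto
    then show ?thesis by blast
  qed
  have nbhd: "\<exists>k. \<forall>y. y - a \<in> closure (\<iota> ` F k) \<longrightarrow> y \<in> U" if "open U" "a \<in> U" for U a
    using open_iff that unfolding F_def by blast
  \<comment> \<open>The common initial segment cancels, and all remaining powers lie in
    \<open>F k\<close>.\<close>
  have sums: "sum (\<lambda>n. x ^ n) A - sum (\<lambda>n. x ^ n) B \<in> F k"
    if "finite A" "finite B" "{..<N} \<subseteq> A" "{..<N} \<subseteq> B" "\<forall>n\<ge>N. x ^ n \<in> F k" for A B N k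
  proof -
    have split: "sum (\<lambda>n. x ^ n) C = sum (\<lambda>n. x ^ n) (C - {..<N}) + sum (\<lambda>n. x ^ n) {..<N}"
      if "finite C" "{..<N} \<subseteq> C" for C
      using that by (intro sum.subset_diff)
    have "sum (\<lambda>n. x ^ n) (A - {..<N}) - sum (\<lambda>n. x ^ n) (B - {..<N}) \<in> F k"
      using that by (intro F_diff F_sum) auto
    then show ?thesis
      unfolding split[OF that(1,3)] split[OF that(2,4)] by (simp only: add_diff_cancel_right)
  qed
  show ?thesis
  proof
    show "\<iota> LL * \<iota> LL_inv = 1"
      by (metis LL_inverse hom_mult hom_one)
    show "(\<lambda>n. \<iota> LL_inv ^ n) \<longlonglongrightarrow> 0"
    proof (rule topological_tendstoI)
      fix U :: "'m set" assume "open U" "0 \<in> U"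
      then obtain k where k: "\<And>y. y - 0 \<in> closure (\<iota> ` F k) \<Longrightarrow> y \<in> U" using nbhd by blast
      obtain N where N: "\<forall>n\<ge>N. x ^ n \<in> F k" using ev by blast
      have "\<iota> x ^ n \<in> U" if "n \<ge> N" for n
      proof -
        have "\<iota> (x ^ n) \<in> closure (\<iota> ` F k)"
          using N that by (intro subsetD[OF closure_subset] imageI) simp
        then show ?thesis using k[of "\<iota> (x ^ n)"] unfolding pow by simp
      qed
      then show "\<forall>\<^sub>F n in sequentially. \<iota> LL_inv ^ n \<in> U"
        unfolding eventually_sequentially x_def by blast
    qed
    define s where "s m = (\<Sum>n<m. \<iota> x ^ n)" for m
    have "convergent s"
    proof (rule complete, intro allI)
      fix k
      obtain N where N: "\<forall>n\<ge>N. x ^ n \<in> F k" using ev by blast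
      have "s i - s j \<in> closure (\<iota> ` F k)" if "i \<ge> N" "j \<ge> N" for i j
      proof -
        have "s i - s j \<in> \<iota> ` F k"
          unfolding s_def sum[OF finite_lessThan] diff
          by (intro imageI sums[OF _ _ _ _ N]) (use that in auto)
        then show ?thesis by (rule subsetD[OF closure_subset])
      qed
      then show "\<exists>N. \<forall>i\<ge>N. \<forall>j\<ge>N. s i - s j \<in> closure (\<iota> ` motivic_filtration k)"
        unfolding F_def by blast
    qed
    then obtain l where l: "s \<longlonglongrightarrow> l" unfolding convergent_def by blast
    have "((\<lambda>n. \<iota> x ^ n) has_sum l) UNIV"
      unfolding has_sum_def
    proof (rule topological_tendstoI)
      fix U :: "'m set" assume "open U" "l \<in> U"
      then obtain k where k: "\<And>y. y - l \<in> closure (\<iota> ` F k) \<Longrightarrow> y \<in> U" using nbhd by blast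
      obtain N where N: "\<forall>n\<ge>N. x ^ n \<in> F k" using ev by blast
      have "sum (\<lambda>n. \<iota> x ^ n) A \<in> U" if A: "finite A" "{..<N} \<subseteq> A" for A
      proof (rule k)
        \<comment> \<open>Unconditional convergence: an arbitrary finite \<open>A\<close> containing
          \<open>{..<N}\<close> is compared with partial sums, and \<open>m\<close> tends to
          infinity inside a closed set.\<close>
        have "sum (\<lambda>n. \<iota> x ^ n) A - s m \<in> closure (\<iota> ` F k)" if "m \<ge> N" for m
        proof -
          have "sum (\<lambda>n. \<iota> x ^ n) A - s m \<in> \<iota> ` F k"
            unfolding s_def sum[OF finite_lessThan] sum[OF A(1)] diff
            by (intro imageI sums[OF _ _ _ _ N]) (use that A in auto)
          then show ?thesis by (rule subsetD[OF closure_subset])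
        qed
        then have "\<forall>\<^sub>F m in sequentially. sum (\<lambda>n. \<iota> x ^ n) A - s m \<in> closure (\<iota> ` F k)"
          unfolding eventually_sequentially by blast
        moreover have "(\<lambda>m. sum (\<lambda>n. \<iota> x ^ n) A - s m) \<longlonglongrightarrow> sum (\<lambda>n. \<iota> x ^ n) A - l"
          by (intro tendsto_diff tendsto_const l)
        ultimately show "sum (\<lambda>n. \<iota> x ^ n) A - l \<in> closure (\<iota> ` F k)"
          by (intro Lim_in_closed_set[OF closed_closure]) auto
      qed
      then show "\<forall>\<^sub>F A in finite_subsets_at_top UNIV. sum (\<lambda>n. \<iota> x ^ n) A \<in> U"
        unfolding eventually_finite_subsets_at_top by (intro exI[of _ "{..<N}"]) auto
    qed
    then show "\<exists>s. ((\<lambda>n. \<iota> LL_inv ^ n) has_sum s) UNIV" unfolding x_def by blast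
  qed
qed

theorem theorem3:
  fixes \<iota> :: "k0_loc \<Rightarrow> 'm::{comm_ring_1, topological_ab_group_add, topological_semigroup_mult, t2_space}"
  assumes "filtration_completion motivic_filtration \<iota>"
  shows "\<exists>I\<^sub>0. solution (\<iota> LL) (\<iota> LL_inv) I\<^sub>0 \<and>
           (\<forall>I. solution (\<iota> LL) (\<iota> LL_inv) I \<longrightarrow> (\<exists>c. \<forall>k. I k = c * I\<^sub>0 k))"
proof -
  interpret lefschetz_inverse "\<iota> LL" "\<iota> LL_inv"
    by (rule lefschetz_inverse_completion[OF assms])
  show ?thesis using solutions_multiples_of_basic_series by blast
qed

end
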